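(* Let $\Gamma$ be a countably infinite discrete group. If $(X_n)_{n\in\mathbb{N}}$ is a countable family of Polish $\Gamma$-flows with no wandering points, then there exists a free minimal subflow of $2^\Gamma$ that is disjoint from $X_n$ for all $n\in\mathbb{N}$.
   Context: A $\Gamma$-flow is a nonempty compact Hausdorff space $X$ equipped with a continuous action of $\Gamma$; it is a Polish $\Gamma$-flow if the underlying space is Polish (equivalently, metrizable). A subflow of $X$ is a nonempty closed $\Gamma$-invariant subset; $X$ is minimal if its only subflow is $X$ itself. A $\Gamma$-flow is free if $\gamma\cdot x\neq x$ for all points $x$ and all non-identity $\gamma\in\Gamma$. The space $2^\Gamma$ of functions $x:\Gamma\to\{0,1\}$ has the product topology and the shift action $(\gamma\cdot x)(\delta)=x(\delta\gamma)$. For $\Gamma$-flows $X,Y$, the product $X\times Y$ is a $\Gamma$-flow with the diagonal action; a joining of $X$ and $Y$ is a subflow $Z\subseteq X\times Y$ that projects onto $X$ and onto $Y$. $X$ and $Y$ are disjoint if their only joining is $X\times Y$. A subset $U\subseteq X$ is wandering if $U\cap(\gamma\cdot U)=\varnothing$ for all but finitely many $\gamma\in\Gamma$; a point $x\in X$ is wandering if it has a wandering neighborhood. *)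

theory Defs
  imports "HOL-Analysis.Analysis" "HOL-Algebra.Group_Action"
begin

text \<open>
  A flow of the group \<open>G\<close> is given by a topology \<open>X\<close> and an action \<open>a\<close> of \<open>G\<close> on the set
  \<open>topspace X\<close>, in the sense of the locale \<^locale>\<open>group_action\<close>. That locale requires
  each \<open>a g\<close> to be extensional (\<open>undefined\<close> outside \<open>topspace X\<close>), hence the
  \<open>\<lambda>x\<in>A. \<dots>\<close> below. The group carries the discrete topology.
\<close>

definition flow :: "('g, 'm) monoid_scheme \<Rightarrow> 'a topology \<Rightarrow> ('g \<Rightarrow> 'a \<Rightarrow> 'a) \<Rightarrow> bool" where
  "flow G X a \<longleftrightarrow>
     topspace X \<noteq> {} \<and> compact_space X \<and> Hausdorff_space X \<and>
     group_action G (topspace X) a \<and>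
     continuous_map (prod_topology (discrete_topology (carrier G)) X) X (\<lambda>(g, x). a g x)"

definition polish_flow :: "('g, 'm) monoid_scheme \<Rightarrow> 'a topology \<Rightarrow> ('g \<Rightarrow> 'a \<Rightarrow> 'a) \<Rightarrow> bool" where
  "polish_flow G X a \<longleftrightarrow> flow G X a \<and> separable_space X \<and> completely_metrizable_space X"

definition subflow ::
  "('g, 'm) monoid_scheme \<Rightarrow> 'a topology \<Rightarrow> ('g \<Rightarrow> 'a \<Rightarrow> 'a) \<Rightarrow> 'a set \<Rightarrow> bool" where
  "subflow G X a Y \<longleftrightarrow> Y \<noteq> {} \<and> closedin X Y \<and> (\<forall>g\<in>carrier G. a g ` Y \<subseteq> Y)"

definition restrict_action :: "('g \<Rightarrow> 'a \<Rightarrow> 'a) \<Rightarrow> 'a set \<Rightarrow> 'g \<Rightarrow> 'a \<Rightarrow> 'a" where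
  "restrict_action a Y = (\<lambda>g. restrict (a g) Y)"

definition minimal_flow :: "('g, 'm) monoid_scheme \<Rightarrow> 'a topology \<Rightarrow> ('g \<Rightarrow> 'a \<Rightarrow> 'a) \<Rightarrow> bool" where
  "minimal_flow G X a \<longleftrightarrow> flow G X a \<and> (\<forall>Y. subflow G X a Y \<longrightarrow> Y = topspace X)"

definition free_flow :: "('g, 'm) monoid_scheme \<Rightarrow> 'a topology \<Rightarrow> ('g \<Rightarrow> 'a \<Rightarrow> 'a) \<Rightarrow> bool" where
  "free_flow G X a \<longleftrightarrow>
     flow G X a \<and> (\<forall>x\<in>topspace X. \<forall>g\<in>carrier G. g \<noteq> \<one>\<^bsub>G\<^esub> \<longrightarrow> a g x \<noteq> x)"

text \<open>
  The space \<open>2\<^sup>G\<close>, with \<open>bool\<close> for \<open>{0, 1}\<close>; its points are the extensional functions on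
  \<open>carrier G\<close>.
\<close>

definition shift_space :: "('g, 'm) monoid_scheme \<Rightarrow> ('g \<Rightarrow> bool) topology" where
  "shift_space G = product_topology (\<lambda>_. discrete_topology UNIV) (carrier G)"

definition shift_action :: "('g, 'm) monoid_scheme \<Rightarrow> 'g \<Rightarrow> ('g \<Rightarrow> bool) \<Rightarrow> 'g \<Rightarrow> bool" where
  "shift_action G g = (\<lambda>x\<in>topspace (shift_space G). \<lambda>d\<in>carrier G. x (d \<otimes>\<^bsub>G\<^esub> g))"

definition diagonal_action ::
  "'a topology \<Rightarrow> ('g \<Rightarrow> 'a \<Rightarrow> 'a) \<Rightarrow> 'b topology \<Rightarrow> ('g \<Rightarrow> 'b \<Rightarrow> 'b) \<Rightarrow> 'g \<Rightarrow> 'a \<times> 'b \<Rightarrow> 'a \<times> 'b" where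
  "diagonal_action X a Y b g = (\<lambda>(x, y)\<in>topspace X \<times> topspace Y. (a g x, b g y))"

definition joining ::
  "('g, 'm) monoid_scheme \<Rightarrow> 'a topology \<Rightarrow> ('g \<Rightarrow> 'a \<Rightarrow> 'a) \<Rightarrow> 'b topology \<Rightarrow> ('g \<Rightarrow> 'b \<Rightarrow> 'b) \<Rightarrow>
   ('a \<times> 'b) set \<Rightarrow> bool" where
  "joining G X a Y b Z \<longleftrightarrow>
     subflow G (prod_topology X Y) (diagonal_action X a Y b) Z \<and>
     fst ` Z = topspace X \<and> snd ` Z = topspace Y"

definition disjoint_flows ::
  "('g, 'm) monoid_scheme \<Rightarrow> 'a topology \<Rightarrow> ('g \<Rightarrow> 'a \<Rightarrow> 'a) \<Rightarrow> 'b topology \<Rightarrow> ('g \<Rightarrow> 'b \<Rightarrow> 'b) \<Rightarrow> bool" where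
  "disjoint_flows G X a Y b \<longleftrightarrow> (\<forall>Z. joining G X a Y b Z \<longrightarrow> Z = topspace X \<times> topspace Y)"

definition wandering_set ::
  "('g, 'm) monoid_scheme \<Rightarrow> 'a topology \<Rightarrow> ('g \<Rightarrow> 'a \<Rightarrow> 'a) \<Rightarrow> 'a set \<Rightarrow> bool" where
  "wandering_set G X a U \<longleftrightarrow>
     U \<subseteq> topspace X \<and> finite {g \<in> carrier G. U \<inter> a g ` U \<noteq> {}}"

definition wandering_point ::
  "('g, 'm) monoid_scheme \<Rightarrow> 'a topology \<Rightarrow> ('g \<Rightarrow> 'a \<Rightarrow> 'a) \<Rightarrow> 'a \<Rightarrow> bool" where
  "wandering_point G X a x \<longleftrightarrow>
     (\<exists>V U. openin X V \<and> x \<in> V \<and> V \<subseteq> U \<and> wandering_set G X a U)"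

end

theory Submission
  imports Defs
begin

text \<open>
  The disjointness statement follows from a property of \<open>Y\<close> alone. Let \<open>\<A>\<close> be a countable family of infinite
  subsets of the group, and suppose that \<open>Y \<subseteq> 2\<^sup>G\<close> is a subflow such that \<open>{g y | g \<in> A}\<close> is dense in \<open>Y\<close> for all
  \<open>y \<in> Y\<close> and \<open>A \<in> \<A>\<close>. If the group itself belongs to \<open>\<A>\<close>, then \<open>Y\<close> is minimal. In a Polish flow \<open>X\<close> without
  wandering points every nonempty open set \<open>B\<close> contains a point \<open>x\<close> whose return set \<open>{g | g x \<in> B}\<close> is infinite,
  by Baire's theorem; for countably many \<open>B\<close>, put these return sets into \<open>\<A>\<close> (lemma \<open>exists_return_sets\<close>).
  If \<open>Z\<close> is a joining of \<open>Y\<close> and \<open>X\<close>, choose \<open>y\<close> with \<open>(y, x) \<in> Z\<close>. For \<open>g\<close> in the return set, \<open>g x\<close> remains in \<open>B\<close>,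
  while \<open>g y\<close> visits every nonempty open \<open>V \<subseteq> Y\<close>. So \<open>Z\<close> meets every \<open>V \<times> B\<close>, and being closed it is everything.

  It remains to construct a free \<open>Y\<close> with dense returns (theorem \<open>exists_free_dense_subshift\<close>). \<open>Y\<close> is the limit of
  a decreasing sequence of patch systems, classes of finite partial configurations that can be glued when
  they are far apart and extended over any finite set. By compactness, density means that each pattern \<open>p\<close>
  that occurs in \<open>Y\<close> is seen in every \<open>y \<in> Y\<close> at one of the places \<open>a s\<close> with \<open>a\<close> in a finite \<open>A' \<subseteq> A\<close>, for
  every \<open>s\<close>. One step of the construction (theorem \<open>patch_system_step\<close>) forces this for one \<open>p\<close> and one \<open>A\<close>. The
  resulting class of patches must again admit gluing and extension, which fails for the naive class: a
  patch may block all but a few of the places \<open>a s\<close>, for many \<open>s\<close> at once, and these may not suffice. Therefore only such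
  patches are kept for which each \<open>s\<close> either sees \<open>p\<close> inside the patch or has half of the places \<open>a s\<close> still free.
  To extend a patch of this kind, one needs a sparse set of sites that contains one of the free places for each \<open>s\<close>
  in a region and blocks at most half of the places for all other \<open>s\<close>. Since \<open>A'\<close> may be chosen long and
  widely spaced after the distance between the sites has been fixed, a random set of sites fails for a given \<open>s\<close> with
  exponentially small probability, and the Lovasz local lemma provides the sites (theorem \<open>exists_has_sites\<close>).

  Freeness at \<open>g\<close> needs some \<open>d\<close> with \<open>y d \<noteq> y (d g)\<close>, for every \<open>y \<in> Y\<close>. The distance between \<open>d\<close> and \<open>d g\<close> is that
  of a conjugate of \<open>g\<close> from the identity. If the centralizer of \<open>g\<close> is infinite, infinitely many \<open>d\<close> give the same
  conjugate, and dense returns along these \<open>d\<close> suffice. Otherwise the distance tends to infinity, and two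
  separate patterns have to be placed at \<open>d\<close> and at \<open>d g\<close>; this is why the construction works with pairs of places
  throughout.
\<close>

section \<open>A counting local lemma\<close>

lemma card_PiE_split:
  assumes "finite D" "K \<subseteq> D" "finite \<Lambda>"
  shows "card {f \<in> D \<rightarrow>\<^sub>E \<Lambda>. P (restrict f K) \<and> Q (restrict f (D - K))}
       \<le> card {g \<in> K \<rightarrow>\<^sub>E \<Lambda>. P g} * card {h \<in> D - K \<rightarrow>\<^sub>E \<Lambda>. Q h}"
proof -
  let ?A = "{f \<in> D \<rightarrow>\<^sub>E \<Lambda>. P (restrict f K) \<and> Q (restrict f (D - K))}"
  let ?B = "{g \<in> K \<rightarrow>\<^sub>E \<Lambda>. P g} \<times> {h \<in> D - K \<rightarrow>\<^sub>E \<Lambda>. Q h}"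
  have "finite (K \<rightarrow>\<^sub>E \<Lambda>)" "finite (D - K \<rightarrow>\<^sub>E \<Lambda>)"
    using assms by (auto intro!: finite_PiE dest: finite_subset)
  then have fin: "finite ?B" by simp
  have inj: "inj_on (\<lambda>f. (restrict f K, restrict f (D - K))) ?A"
  proof (rule inj_onI)
    fix f g assume f: "f \<in> ?A" and g: "g \<in> ?A"
      and eq: "(restrict f K, restrict f (D - K)) = (restrict g K, restrict g (D - K))"
    have "f x = g x" if "x \<in> D" for x
      using eq that by (cases "x \<in> K") (auto simp: fun_eq_iff restrict_def split: if_splits)
    then show "f = g" using f g by (intro PiE_ext[of f D "\<lambda>_. \<Lambda>" g]) auto
  qed
  have "(\<lambda>f. (restrict f K, restrict f (D - K))) ` ?A \<subseteq> ?B"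
    using assms by (auto simp: PiE_iff)
  from card_inj_on_le[OF inj this fin] show ?thesis
    by (simp add: card_cartesian_product)
qed

lemma card_blocks_le:
  fixes c :: real
  assumes "finite J" "finite D" "finite \<Lambda>" "c \<ge> 0"
    and "\<And>i. i \<in> J \<Longrightarrow> K i \<subseteq> D" "disjoint_family_on K J"
    and "\<And>i. i \<in> J \<Longrightarrow> real (card {g \<in> K i \<rightarrow>\<^sub>E \<Lambda>. P i g}) \<le> c * real (card \<Lambda>) ^ card (K i)"
  shows "real (card {f \<in> D \<rightarrow>\<^sub>E \<Lambda>. \<forall>i\<in>J. P i (restrict f (K i))}) \<le> c ^ card J * real (card \<Lambda>) ^ card D"
  using assms
proof (induction J arbitrary: D rule: finite_induct)
  case empty
  then show ?case by (simp add: card_PiE)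
next
  case (insert j J)
  let ?S = "{f \<in> D - K j \<rightarrow>\<^sub>E \<Lambda>. \<forall>i\<in>J. P i (restrict f (K i))}"
  have sub: "K i \<subseteq> D - K j" if "i \<in> J" for i
    using insert.prems(4)[of i] insert.prems(5) insert.hyps that
    unfolding disjoint_family_on_def by (metis Diff_disjoint Diff_subset_conv inf.commute insertCI le_supI2 Un_Diff_Int 
     Diff_eq disjoint_eq_subset_Compl inf.bounded_iff)
  have IH: "real (card ?S) \<le> c ^ card J * real (card \<Lambda>) ^ card (D - K j)"
    using insert.prems sub by (intro insert.IH) (auto simp: disjoint_family_on_def)
  have r: "restrict f ((D - K j) \<inter> K i) = restrict f (K i)" if "i \<in> J" for i f
    using sub[OF that] by (simp add: Int_absorb1)
  have Kj: "K j \<subseteq> D" using insert.prems by auto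
  have "{f \<in> D \<rightarrow>\<^sub>E \<Lambda>. \<forall>i\<in>insert j J. P i (restrict f (K i))} =
     {f \<in> D \<rightarrow>\<^sub>E \<Lambda>. P j (restrict f (K j)) \<and> (\<forall>i\<in>J. P i (restrict (restrict f (D - K j)) (K i)))}"
    by (auto simp: r)
  then have "card {f \<in> D \<rightarrow>\<^sub>E \<Lambda>. \<forall>i\<in>insert j J. P i (restrict f (K i))}
     \<le> card {g \<in> K j \<rightarrow>\<^sub>E \<Lambda>. P j g} * card ?S"
    using card_PiE_split[OF insert.prems(1) Kj insert.prems(2),
        of "P j" "\<lambda>h. \<forall>i\<in>J. P i (restrict h (K i))"] by simp
  then have "real (card {f \<in> D \<rightarrow>\<^sub>E \<Lambda>. \<forall>i\<in>insert j J. P i (restrict f (K i))})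
     \<le> real (card {g \<in> K j \<rightarrow>\<^sub>E \<Lambda>. P j g}) * real (card ?S)"
    by (simp flip: of_nat_mult)
  also have "\<dots> \<le> (c * real (card \<Lambda>) ^ card (K j)) * (c ^ card J * real (card \<Lambda>) ^ card (D - K j))"
    using insert.prems(3,6) IH by (intro mult_mono) auto
  also have "\<dots> = c ^ card (insert j J) * real (card \<Lambda>) ^ (card (K j) + card (D - K j))"
    using insert.hyps by (simp add: power_add)
  also have "card (K j) + card (D - K j) = card D"
    using Kj insert.prems(1) by (metis card_Diff_subset card_mono finite_subset le_add_diff_inverse)
  finally show ?case .
qed

text \<open>
  A counting form of the Lovasz local lemma, in the style of Rosenfeld. Let \<open>N U\<close> be the number of
  labellings of \<open>U\<close> that avoid all bad events living inside \<open>U\<close>. The claim proved by induction is that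
  each new point multiplies \<open>N\<close> by at least \<open>b = (1 - \<epsilon>) * card \<Lambda>\<close>: a labelling that becomes bad when
  \<open>v\<close> is added is bad for some event \<open>e\<close> through \<open>v\<close>, hence it consists of a bad labelling of \<open>dm e\<close> and a
  good labelling of the remaining points, and by induction there are few good labellings of the
  remaining points in comparison with \<open>N (U - {v})\<close>.
\<close>

lemma local_lemma_counting:
  fixes p \<epsilon> :: real
  assumes "finite J" "finite \<Omega>" "finite \<Lambda>" "\<Lambda> \<noteq> {}"
    and dm: "\<And>e. e \<in> J \<Longrightarrow> dm e \<subseteq> \<Omega>"
    and dmc: "\<And>e. e \<in> J \<Longrightarrow> card (dm e) \<le> D"
    and bad: "\<And>e. e \<in> J \<Longrightarrow> real (card {g \<in> dm e \<rightarrow>\<^sub>E \<Lambda>. bad e g}) \<le> p * real (card \<Lambda>) ^ card (dm e)"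
    and deg: "\<And>v. v \<in> \<Omega> \<Longrightarrow> card {e \<in> J. v \<in> dm e} \<le> k"
    and eps: "0 < \<epsilon>" "\<epsilon> < 1" and p: "0 \<le> p" "p < 1" and kp: "real k * p \<le> \<epsilon> * (1 - \<epsilon>) ^ D"
  shows "\<exists>f \<in> \<Omega> \<rightarrow>\<^sub>E \<Lambda>. \<forall>e\<in>J. \<not> bad e (restrict f (dm e))"
proof -
  define good where "good U = {f \<in> U \<rightarrow>\<^sub>E \<Lambda>. \<forall>e\<in>J. dm e \<subseteq> U \<longrightarrow> \<not> bad e (restrict f (dm e))}" for U
  define L where "L = real (card \<Lambda>)"
  define b where "b = L * (1 - \<epsilon>)"
  have L: "L > 0" using assms(3,4) by (simp add: L_def card_gt_0_iff)
  have b: "b > 0" using L eps by (simp add: b_def)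
  have fing: "finite (good U)" if "finite U" for U
    using that assms(3) by (auto simp: good_def intro!: finite_subset[OF _ finite_PiE[of U "\<lambda>_. \<Lambda>"]])
  have main: "real (card (good U)) \<ge> b ^ card (U - W) * real (card (good W))"
    if "finite U" "U \<subseteq> \<Omega>" "W \<subseteq> U" for U W
    using that
  proof (induction U arbitrary: W rule: finite_psubset_induct)
    case (psubset U)
    show ?case
    proof (cases "W = U")
      case False
      then obtain v where v: "v \<in> U" "v \<notin> W" using psubset.prems by auto
      define U' where "U' = U - {v}"
      have U': "finite U'" "U' \<subset> U" "U' \<subseteq> \<Omega>" "W \<subseteq> U'" "U = insert v U'" "v \<notin> U'"
        using psubset v by (auto simp: U'_def)
      define Ev where "Ev = {e \<in> J. v \<in> dm e \<and> dm e \<subseteq> U}"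
      have finEv: "finite Ev" using assms(1) by (simp add: Ev_def)
      \<comment> \<open>\<open>All\<close>: good labellings before \<open>v\<close>, extended arbitrarily to \<open>v\<close>. \<open>B e\<close> contains those that are spoiled by \<open>e\<close>.\<close>
      define All where "All = {f \<in> U \<rightarrow>\<^sub>E \<Lambda>. restrict f U' \<in> good U'}"
      define B where "B e = {f \<in> U \<rightarrow>\<^sub>E \<Lambda>. bad e (restrict f (dm e)) \<and> restrict f (U - dm e) \<in> good (U - dm e)}" for e
      have finAll: "finite (U \<rightarrow>\<^sub>E \<Lambda>)" using psubset.hyps assms(3) by (auto intro: finite_PiE)
      have cAll: "real (card All) = L * real (card (good U'))"
      proof -
        have "bij_betw (\<lambda>(x, g). g(v := x)) (\<Lambda> \<times> good U') All"
        proof (rule bij_betw_byWitness[where f' = "\<lambda>f. (f v, restrict f U')"])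
          show "\<forall>a\<in>\<Lambda> \<times> good U'. (\<lambda>f. (f v, restrict f U')) ((\<lambda>(x, g). g(v := x)) a) = a"
            using U'(6) by (auto simp: good_def fun_eq_iff restrict_def PiE_iff extensional_def)
          show "\<forall>f\<in>All. (\<lambda>(x, g). g(v := x)) (f v, restrict f U') = f"
            using U'(5) by (auto simp: All_def fun_eq_iff restrict_def PiE_iff extensional_def)
          have *: "restrict (g(v := x)) U' = g" if "g \<in> good U'" for g x
            using that U'(6) by (auto simp: good_def fun_eq_iff restrict_def PiE_iff extensional_def)
          show "(\<lambda>(x, g). g(v := x)) ` (\<Lambda> \<times> good U') \<subseteq> All"
          proof clarify
            fix x g assume "x \<in> \<Lambda>" "g \<in> good U'"
            then have "g(v := x) \<in> U \<rightarrow>\<^sub>E \<Lambda>"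
              using U'(5) by (auto simp: good_def PiE_iff extensional_def)
            then show "g(v := x) \<in> All" using *[OF \<open>g \<in> good U'\<close>] \<open>g \<in> good U'\<close> unfolding All_def
              by (simp only: mem_Collect_eq)
          qed
          show "(\<lambda>f. (f v, restrict f U')) ` All \<subseteq> \<Lambda> \<times> good U'"
            using U'(5) by (auto simp: All_def PiE_iff)
        qed
        then show ?thesis
          by (metis L_def bij_betw_same_card card_cartesian_product of_nat_mult)
      qed
      have sub: "All \<subseteq> good U \<union> (\<Union>e\<in>Ev. B e)"
      proof
        fix f assume f: "f \<in> All"
        have rr: "restrict (restrict f A) C = restrict f C" if "C \<subseteq> A" for A C
          using that by (auto simp: fun_eq_iff restrict_def)
        show "f \<in> good U \<union> (\<Union>e\<in>Ev. B e)"
        proof (cases "f \<in> good U")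
          case False
          then obtain e where e: "e \<in> J" "dm e \<subseteq> U" "bad e (restrict f (dm e))"
            using f by (auto simp: good_def All_def)
          have "v \<in> dm e"
          proof (rule ccontr)
            assume "v \<notin> dm e"
            then have "dm e \<subseteq> U'" using e by (auto simp: U'_def)
            moreover have "\<not> bad e (restrict (restrict f U') (dm e))"
              using f e \<open>dm e \<subseteq> U'\<close> unfolding All_def good_def by blast
            ultimately show False using e by (simp add: rr del: restrict_restrict)
          qed
          then have 1: "e \<in> Ev" "U - dm e \<subseteq> U'" using e by (auto simp: Ev_def U'_def)
          have "\<not> bad e' (restrict f (dm e'))" if "e' \<in> J" "dm e' \<subseteq> U - dm e" for e'
          proof -
            have "dm e' \<subseteq> U'" using that 1(2) by blast
            moreover have "\<not> bad e' (restrict (restrict f U') (dm e'))"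
              using f that \<open>dm e' \<subseteq> U'\<close> unfolding All_def good_def by blast
            ultimately show ?thesis by (simp add: rr del: restrict_restrict)
          qed
          moreover have "restrict f (U - dm e) \<in> U - dm e \<rightarrow>\<^sub>E \<Lambda>"
            using f by (auto simp: All_def)
          ultimately have "restrict f (U - dm e) \<in> good (U - dm e)"
            by (simp add: good_def rr del: restrict_restrict)
          then have "f \<in> B e" using f e by (auto simp: B_def All_def)
          then show ?thesis using 1 by auto
        qed auto
      qed
      have cB: "real (card (B e)) \<le> p / (1 - \<epsilon>) ^ D * L * real (card (good U'))" if "e \<in> Ev" for e
      proof -
        have e: "e \<in> J" "v \<in> dm e" "dm e \<subseteq> U" using that by (auto simp: Ev_def)
        have findm: "finite (dm e)" using e psubset.hyps finite_subset by blast
        have "card (B e) \<le> card {g \<in> dm e \<rightarrow>\<^sub>E \<Lambda>. bad e g} * card {h \<in> U - dm e \<rightarrow>\<^sub>E \<Lambda>. h \<in> good (U - dm e)}"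
          unfolding B_def by (rule card_PiE_split[OF psubset.hyps(1) e(3) assms(3)])
        also have "{h \<in> U - dm e \<rightarrow>\<^sub>E \<Lambda>. h \<in> good (U - dm e)} = good (U - dm e)"
          by (auto simp: good_def)
        finally have "real (card (B e)) \<le> real (card {g \<in> dm e \<rightarrow>\<^sub>E \<Lambda>. bad e g}) * real (card (good (U - dm e)))"
          by (simp flip: of_nat_mult)
        also have "\<dots> \<le> (p * L ^ card (dm e)) * real (card (good (U - dm e)))"
          using bad[OF e(1)] by (intro mult_right_mono) (auto simp: L_def)
        finally have 1: "real (card (B e)) \<le> (p * L ^ card (dm e)) * real (card (good (U - dm e)))" .
        define d where "d = card (dm e) - 1"
        have d: "card (dm e) = Suc d" using e findm by (metis Suc_pred' card_gt_0_iff d_def empty_iff)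
        have "U' - (U - dm e) = dm e - {v}" using e by (auto simp: U'_def)
        then have c: "card (U' - (U - dm e)) = d" using e findm by (simp add: d_def)
        have "b ^ d * real (card (good (U - dm e))) \<le> real (card (good U'))"
          using psubset.IH[OF U'(2) U'(3), of "U - dm e"] e c by (auto simp: U'_def)
        then have 2: "real (card (good (U - dm e))) \<le> real (card (good U')) / b ^ d"
          using b by (simp add: field_simps)
        have "real (card (B e)) \<le> (p * L ^ card (dm e)) * (real (card (good U')) / b ^ d)"
          using 1 2 p L by (meson mult_left_mono mult_nonneg_nonneg order_trans zero_le_power less_imp_le)
        also have "\<dots> = p / (1 - \<epsilon>) ^ d * L * real (card (good U'))"
        proof -
          have "b ^ d = L ^ d * (1 - \<epsilon>) ^ d" by (simp add: b_def power_mult_distrib)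
          then show ?thesis using L eps by (simp add: d)
        qed
        also have "\<dots> \<le> p / (1 - \<epsilon>) ^ D * L * real (card (good U'))"
        proof -
          have "d \<le> D" using dmc[OF e(1)] d by simp
          then have "(1 - \<epsilon>) ^ D \<le> (1 - \<epsilon>) ^ d" using eps by (intro power_decreasing) auto
          then have "p / (1 - \<epsilon>) ^ d \<le> p / (1 - \<epsilon>) ^ D" using eps p by (intro divide_left_mono) auto
          then show ?thesis using L by (intro mult_right_mono) auto
        qed
        finally show ?thesis .
      qed
      have "card Ev \<le> k"
      proof -
        have "card Ev \<le> card {e \<in> J. v \<in> dm e}" using assms(1) by (intro card_mono) (auto simp: Ev_def)
        also have "\<dots> \<le> k" using deg v psubset.prems by auto
        finally show ?thesis .
      qed
      have "real (card All) \<le> real (card (good U)) + (\<Sum>e\<in>Ev. real (card (B e)))"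
      proof -
        have finB: "finite (B e)" for e using finAll by (simp add: B_def)
        have "card All \<le> card (good U \<union> (\<Union>e\<in>Ev. B e))"
          using sub fing[OF psubset.hyps(1)] finB finEv by (intro card_mono) auto
        also have "\<dots> \<le> card (good U) + card (\<Union>e\<in>Ev. B e)" by (rule card_Un_le)
        also have "\<dots> \<le> card (good U) + (\<Sum>e\<in>Ev. card (B e))"
          using card_UN_le[OF finEv, of B] by simp
        finally show ?thesis by (simp flip: of_nat_sum of_nat_add)
      qed
      also have "(\<Sum>e\<in>Ev. real (card (B e))) \<le> real (card Ev) * (p / (1 - \<epsilon>) ^ D * L * real (card (good U')))"
        by (rule sum_bounded_above) (rule cB)
      also have "\<dots> \<le> real k * (p / (1 - \<epsilon>) ^ D * L * real (card (good U')))"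
        using \<open>card Ev \<le> k\<close> p eps L by (intro mult_right_mono) auto
      also have "\<dots> = (real k * p / (1 - \<epsilon>) ^ D) * (L * real (card (good U')))" by simp
      also have "\<dots> \<le> \<epsilon> * (L * real (card (good U')))"
        using kp eps L by (intro mult_right_mono) (auto simp: field_simps)
      finally have "L * real (card (good U')) \<le> real (card (good U)) + \<epsilon> * (L * real (card (good U')))"
        using cAll by simp
      then have 3: "b * real (card (good U')) \<le> real (card (good U))"
        by (simp add: b_def algebra_simps)
      have "card (U - W) = Suc (card (U' - W))"
        using U' v by (simp add: insert_Diff_if)
      then have "b ^ card (U - W) * real (card (good W)) = b * (b ^ card (U' - W) * real (card (good W)))" by simp
      also have "\<dots> \<le> b * real (card (good U'))"
        using psubset.IH[OF U'(2,3,4)] b by (intro mult_left_mono) auto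
      finally show ?thesis using 3 by simp
    qed simp
  qed
  have "good {} = {\<lambda>_. undefined}"
  proof -
    have "\<not> bad e (\<lambda>_. undefined)" if "e \<in> J" "dm e = {}" for e
    proof
      assume "bad e (\<lambda>_. undefined)"
      then have "{g \<in> dm e \<rightarrow>\<^sub>E \<Lambda>. bad e g} = {\<lambda>_. undefined}" using that by auto
      then show False using bad[OF that(1)] that p by simp
    qed
    then show ?thesis by (auto simp: good_def restrict_def)
  qed
  then have "real (card (good \<Omega>)) \<ge> b ^ card \<Omega>" using main[of \<Omega> "{}"] assms(2) by simp
  then have "card (good \<Omega>) > 0" using b
    by (metis of_nat_0_less_iff order_less_le_trans zero_less_power)
  then obtain f where "f \<in> good \<Omega>" by (metis card_gt_0_iff equals0I)
  then show ?thesis using dm by (auto simp: good_def)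
qed

text \<open>
  The numerical input for the local lemma with \<open>2 * m\<close> independent blocks per event: the failure
  probability \<open>2 * u ^ m\<close> decays exponentially in \<open>m\<close>, while the number of events through a point grows only
  linearly. With \<open>\<epsilon> = (1 - u) / (8 * \<beta>)\<close>, Bernoulli's inequality gives \<open>(1 - \<epsilon>) ^ (4 * \<beta>) \<ge> (1 + u) / 2 > u\<close>,
  so the loss \<open>(1 - \<epsilon>) ^ (4 * \<beta> * m)\<close> still leaves exponential decay.
\<close>

lemma local_lemma_parameters:
  fixes \<beta> L :: nat
  assumes "\<beta> \<ge> 1" "L \<ge> 2"
  defines "u \<equiv> 1 - 1 / real L ^ (2 * \<beta>)"
  shows "\<exists>m \<epsilon>. m \<ge> 2 \<and> 0 < \<epsilon> \<and> \<epsilon> < 1 \<and> 2 * u ^ m < 1 \<and>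
    real (4 * m * \<beta>) * (2 * u ^ m) \<le> \<epsilon> * (1 - \<epsilon>) ^ (4 * \<beta> * m)"
proof -
  have "real L ^ (2 * \<beta>) > 1" using assms by (intro one_less_power) auto
  then have u: "0 < u" "u < 1" unfolding u_def using assms by (auto simp: field_simps)
  define \<epsilon> where "\<epsilon> = (1 - u) / (8 * real \<beta>)"
  have \<epsilon>: "0 < \<epsilon>" "\<epsilon> < 1" using u assms(1) by (auto simp: \<epsilon>_def field_simps)
  define w where "w = u / ((1 + u) / 2)"
  have w: "0 < w" "w < 1" "u \<le> w" using u by (auto simp: w_def field_simps)
  have "1 - real (4 * \<beta>) * \<epsilon> \<le> (1 - \<epsilon>) ^ (4 * \<beta>)"
    using Bernoulli_inequality[of "-\<epsilon>" "4 * \<beta>"] \<epsilon> by simp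
  moreover have "1 - real (4 * \<beta>) * \<epsilon> = (1 + u) / 2" using assms(1) by (simp add: \<epsilon>_def field_simps)
  ultimately have base: "(1 + u) / 2 \<le> (1 - \<epsilon>) ^ (4 * \<beta>)" by simp
  have "(\<lambda>m. 8 * real \<beta> * (real m * w ^ m)) \<longlonglongrightarrow> 8 * real \<beta> * 0"
    using w by (intro tendsto_mult_left powser_times_n_limit_0) auto
  then have "\<forall>\<^sub>F m in sequentially. 8 * real \<beta> * (real m * w ^ m) < \<epsilon>"
    using order_tendstoD(2)[of _ _ _ \<epsilon>] \<epsilon> by simp
  then have "\<forall>\<^sub>F m in sequentially. 8 * real \<beta> * (real m * w ^ m) < \<epsilon> \<and> m \<ge> 2"
    by (intro eventually_conj eventually_ge_at_top)
  then obtain m where m: "8 * real \<beta> * (real m * w ^ m) < \<epsilon>" "m \<ge> 2"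
    by (auto simp: eventually_sequentially)
  have "2 * u ^ m \<le> 2 * w ^ m" using u w by (simp add: power_mono)
  also have "\<dots> \<le> 8 * real \<beta> * (real m * w ^ m)"
  proof -
    have "1 \<le> 4 * \<beta> * m" using assms(1) m(2) by simp
    then have "1 \<le> real (4 * \<beta> * m)" by linarith
    then have "1 * (2 * w ^ m) \<le> real (4 * \<beta> * m) * (2 * w ^ m)" using w by (intro mult_right_mono) auto
    then show ?thesis by (simp add: algebra_simps)
  qed
  finally have 1: "2 * u ^ m < 1" using m \<epsilon> by simp
  have "real (4 * m * \<beta>) * (2 * u ^ m) = (8 * real \<beta> * (real m * w ^ m)) * ((1 + u) / 2) ^ m"
  proof -
    have "w * ((1 + u) / 2) = u" using u by (simp add: w_def)
    then have "u ^ m = w ^ m * ((1 + u) / 2) ^ m" by (metis power_mult_distrib)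
    then show ?thesis by simp
  qed
  also have "\<dots> \<le> \<epsilon> * ((1 - \<epsilon>) ^ (4 * \<beta>)) ^ m"
    using base m u \<epsilon> w by (intro mult_mono power_mono) auto
  also have "\<dots> = \<epsilon> * (1 - \<epsilon>) ^ (4 * \<beta> * m)" by (simp add: power_mult)
  finally show ?thesis using m \<epsilon> 1 by blast
qed

section \<open>Groups with a proper length function\<close>

locale length_group = group G for G :: "('g, 'm) monoid_scheme" (structure) +
  fixes len :: "'g \<Rightarrow> nat"
  assumes len_one: "len \<one> = 0"
    and len_inv: "x \<in> carrier G \<Longrightarrow> len (inv x) = len x"
    and len_mult: "x \<in> carrier G \<Longrightarrow> y \<in> carrier G \<Longrightarrow> len (x \<otimes> y) \<le> len x + len y"
    and finite_len: "finite {x \<in> carrier G. len x \<le> r}"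
begin

text \<open>
  The distance is invariant under right translations, matching the shift action \<open>(g y) d = y (d g)\<close>:
  the window \<open>F\<close> of the shifted point \<open>g y\<close> is the window \<open>F g\<close> of \<open>y\<close>.
\<close>

definition gdist :: "'g \<Rightarrow> 'g \<Rightarrow> nat" where
  "gdist x y = len (x \<otimes> inv y)"

lemma gdist_self [simp]: "x \<in> carrier G \<Longrightarrow> gdist x x = 0"
  by (simp add: gdist_def len_one)

lemma gdist_commute: "x \<in> carrier G \<Longrightarrow> y \<in> carrier G \<Longrightarrow> gdist x y = gdist y x"
  using len_inv[of "x \<otimes> inv y"] by (simp add: gdist_def inv_mult_group)

lemma gdist_triangle:
  assumes "x \<in> carrier G" "y \<in> carrier G" "z \<in> carrier G"
  shows "gdist x z \<le> gdist x y + gdist y z"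
proof -
  have "x \<otimes> inv z = (x \<otimes> inv y) \<otimes> (y \<otimes> inv z)"
    using assms by (metis inv_closed inv_solve_right m_assoc m_closed)
  then show ?thesis using len_mult[of "x \<otimes> inv y" "y \<otimes> inv z"] assms by (simp add: gdist_def)
qed

lemma gdist_translate [simp]:
  assumes "x \<in> carrier G" "y \<in> carrier G" "s \<in> carrier G"
  shows "gdist (x \<otimes> s) (y \<otimes> s) = gdist x y"
proof -
  have "(x \<otimes> s) \<otimes> inv (y \<otimes> s) = x \<otimes> inv y"
    using assms by (simp add: inv_mult_group m_assoc) (metis inv_closed l_inv l_one m_assoc r_inv)
  then show ?thesis by (simp add: gdist_def)
qed

lemma gdist_one: "x \<in> carrier G \<Longrightarrow> gdist x \<one> = len x"
  by (simp add: gdist_def)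

definition ball_card :: "nat \<Rightarrow> nat" where
  "ball_card r = card {x \<in> carrier G. len x \<le> r}"

lemma ball_card_pos: "ball_card r \<ge> 1"
proof -
  have "\<one> \<in> {x \<in> carrier G. len x \<le> r}" by (simp add: len_one)
  then show ?thesis unfolding ball_card_def using finite_len[of r] by (metis One_nat_def Suc_leI card_gt_0_iff empty_iff)
qed

lemma
  assumes "y \<in> carrier G"
  shows finite_gdist: "finite {x \<in> carrier G. gdist x y \<le> r}"
    and card_gdist: "card {x \<in> carrier G. gdist x y \<le> r} \<le> ball_card r"
proof -
  have inj: "inj_on (\<lambda>x. x \<otimes> inv y) {x \<in> carrier G. gdist x y \<le> r}"
    using assms by (auto simp: inj_on_def)
  have sub: "(\<lambda>x. x \<otimes> inv y) ` {x \<in> carrier G. gdist x y \<le> r} \<subseteq> {x \<in> carrier G. len x \<le> r}"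
    using assms by (auto simp: gdist_def)
  show "finite {x \<in> carrier G. gdist x y \<le> r}"
    using inj sub finite_len by (rule inj_on_finite)
  show "card {x \<in> carrier G. gdist x y \<le> r} \<le> ball_card r"
    unfolding ball_card_def using inj sub finite_len by (rule card_inj_on_le)
qed

lemma
  assumes "v \<in> carrier G" "c \<in> carrier G"
  shows finite_gdist_translates: "finite {s \<in> carrier G. gdist v (c \<otimes> s) \<le> r}"
    and card_gdist_translates: "card {s \<in> carrier G. gdist v (c \<otimes> s) \<le> r} \<le> ball_card r"
proof -
  have inj: "inj_on (\<lambda>s. c \<otimes> s) {s \<in> carrier G. gdist v (c \<otimes> s) \<le> r}"
    using assms by (auto simp: inj_on_def)
  have sub: "(\<lambda>s. c \<otimes> s) ` {s \<in> carrier G. gdist v (c \<otimes> s) \<le> r} \<subseteq> {x \<in> carrier G. gdist x v \<le> r}"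
    using assms by (auto simp: gdist_commute)
  show "finite {s \<in> carrier G. gdist v (c \<otimes> s) \<le> r}"
    using inj sub finite_gdist[OF assms(1)] by (rule inj_on_finite)
  show "card {s \<in> carrier G. gdist v (c \<otimes> s) \<le> r} \<le> ball_card r"
    using card_inj_on_le[OF inj sub finite_gdist[OF assms(1)]] card_gdist[OF assms(1), of r] by simp
qed

end

text \<open>
  Word length with respect to all elements as generators, where the letter \<open>y\<close> has a weight that depends
  on the positions of \<open>y\<close> and of its inverse in an enumeration. Finitely many letters have weight at most
  \<open>r\<close>, and every weight is positive, so balls are finite.
\<close>

lemma exists_length_group:
  assumes "group G" "countable (carrier G)"
  shows "\<exists>len. length_group G len"
proof -
  interpret group G by fact
  define c where "c y = Suc (to_nat_on (carrier G) y + to_nat_on (carrier G) (inv\<^bsub>G\<^esub> y))" for y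
  define pr where "pr = (\<lambda>ys. foldr (\<otimes>\<^bsub>G\<^esub>) ys \<one>\<^bsub>G\<^esub>)"
  define wt where "wt ys = sum_list (map c ys)" for ys
  have pr_closed: "pr ys \<in> carrier G" if "set ys \<subseteq> carrier G" for ys
    using that by (induction ys) (auto simp: pr_def)
  have pr_append: "pr (xs @ ys) = pr xs \<otimes>\<^bsub>G\<^esub> pr ys" if "set xs \<subseteq> carrier G" "set ys \<subseteq> carrier G" for xs ys
    using that pr_closed by (induction xs) (auto simp: pr_def m_assoc)
  have pr_rev: "pr (rev (map (\<lambda>y. inv\<^bsub>G\<^esub> y) ys)) = inv\<^bsub>G\<^esub> (pr ys)" if "set ys \<subseteq> carrier G" for ys
    using that
  proof (induction ys)
    case (Cons y ys)
    have "set (rev (map (\<lambda>y. inv\<^bsub>G\<^esub> y) ys)) \<subseteq> carrier G" "set [inv\<^bsub>G\<^esub> y] \<subseteq> carrier G"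
      using Cons.prems by auto
    from pr_append[OF this]
    have "pr (rev (map (\<lambda>y. inv\<^bsub>G\<^esub> y) (y # ys))) = inv\<^bsub>G\<^esub> (pr ys) \<otimes>\<^bsub>G\<^esub> pr [inv\<^bsub>G\<^esub> y]"
      using Cons by simp
    also have "\<dots> = inv\<^bsub>G\<^esub> (pr (y # ys))"
      using Cons.prems pr_closed[of ys] by (simp add: pr_def inv_mult_group)
    finally show ?case .
  qed (simp add: pr_def)
  define L where "L x n \<longleftrightarrow> (\<exists>ys. set ys \<subseteq> carrier G \<and> pr ys = x \<and> wt ys = n)" for x n
  define len where "len x = (LEAST n. L x n)" for x
  have ex: "L x (len x)" if "x \<in> carrier G" for x
  proof -
    have "L x (wt [x])" unfolding L_def by (rule exI[of _ "[x]"]) (use that in \<open>simp add: pr_def\<close>)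
    then show ?thesis unfolding len_def by (rule LeastI)
  qed
  have le: "len x \<le> n" if "L x n" for x n using that unfolding len_def by (rule Least_le)
  have "length_group G len"
  proof
    have "L \<one>\<^bsub>G\<^esub> 0" unfolding L_def by (rule exI[of _ "[]"]) (simp add: pr_def wt_def)
    then show "len \<one>\<^bsub>G\<^esub> = 0" using le by fastforce
  next
    have 1: "len (inv\<^bsub>G\<^esub> x) \<le> len x" if x: "x \<in> carrier G" for x
    proof -
      obtain ys where ys: "set ys \<subseteq> carrier G" "pr ys = x" "wt ys = len x" using ex[OF x] by (auto simp: L_def)
      have "wt (rev (map (\<lambda>y. inv\<^bsub>G\<^esub> y) ys)) = wt ys"
        using ys(1) by (induction ys) (auto simp: wt_def c_def)
      then have "L (inv\<^bsub>G\<^esub> x) (len x)" unfolding L_def using ys pr_rev[OF ys(1)]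
        by (intro exI[of _ "rev (map (\<lambda>y. inv\<^bsub>G\<^esub> y) ys)"]) auto
      then show ?thesis by (rule le)
    qed
    show "len (inv\<^bsub>G\<^esub> x) = len x" if "x \<in> carrier G" for x
      using 1[OF that] 1[of "inv\<^bsub>G\<^esub> x"] that by simp
  next
    fix x y assume xy: "x \<in> carrier G" "y \<in> carrier G"
    obtain xs where xs: "set xs \<subseteq> carrier G" "pr xs = x" "wt xs = len x" using ex[OF xy(1)] by (auto simp: L_def)
    obtain ys where ys: "set ys \<subseteq> carrier G" "pr ys = y" "wt ys = len y" using ex[OF xy(2)] by (auto simp: L_def)
    have "L (x \<otimes>\<^bsub>G\<^esub> y) (len x + len y)" unfolding L_def
      using xs ys pr_append by (intro exI[of _ "xs @ ys"]) (auto simp: wt_def)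
    then show "len (x \<otimes>\<^bsub>G\<^esub> y) \<le> len x + len y" by (rule le)
  next
    fix r
    let ?F = "{y \<in> carrier G. c y \<le> r}"
    have "?F \<subseteq> from_nat_into (carrier G) ` {..r}"
    proof
      fix y assume y: "y \<in> ?F"
      then have "y = from_nat_into (carrier G) (to_nat_on (carrier G) y)" using assms(2) by simp
      moreover have "to_nat_on (carrier G) y \<le> r" using y by (simp add: c_def)
      ultimately show "y \<in> from_nat_into (carrier G) ` {..r}" by blast
    qed
    then have "finite ?F" by (rule finite_subset) simp
    then have "finite {ys. set ys \<subseteq> ?F \<and> length ys \<le> r}" by (rule finite_lists_length_le)
    moreover have "{x \<in> carrier G. len x \<le> r} \<subseteq> pr ` {ys. set ys \<subseteq> ?F \<and> length ys \<le> r}"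
    proof
      fix x assume x: "x \<in> {x \<in> carrier G. len x \<le> r}"
      then obtain ys where ys: "set ys \<subseteq> carrier G" "pr ys = x" "wt ys = len x" using ex[of x] by (auto simp: L_def)
      have "c y \<le> wt ys" if "y \<in> set ys" for y using that by (auto simp: wt_def intro: member_le_sum_list)
      moreover have "length ys \<le> wt ys" by (induction ys) (auto simp: wt_def c_def)
      ultimately have "ys \<in> {ys. set ys \<subseteq> ?F \<and> length ys \<le> r}" using ys x by fastforce
      then show "x \<in> pr ` {ys. set ys \<subseteq> ?F \<and> length ys \<le> r}" using ys(2) by blast
    qed
    ultimately show "finite {x \<in> carrier G. len x \<le> r}" by (rule finite_surj)
  qed
  then show ?thesis by blast
qed

context length_group begin

section \<open>Sparse sets of sites\<close>

definition spread :: "nat \<Rightarrow> ('g \<times> 'g) set \<Rightarrow> bool" where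
  "spread r A \<longleftrightarrow> finite A \<and> A \<subseteq> carrier G \<times> carrier G \<and>
     (\<forall>p\<in>A. gdist (fst p) (snd p) > r) \<and>
     (\<forall>p\<in>A. \<forall>q\<in>A. p \<noteq> q \<longrightarrow> (\<forall>x\<in>{fst p, snd p}. \<forall>y\<in>{fst q, snd q}. gdist x y > r))"

text \<open>
  Two kinds of sites, \<open>S0\<close> and \<open>S1\<close>, are to be placed in a finite region \<open>\<Omega>\<close>, far from each other, so that
  every translate of the list \<open>A\<close> with at least half of its pairs in \<open>\<Omega>\<close> receives a complete pair of
  sites. The last condition protects the other translates: sites placed near the border of \<open>\<Omega>\<close> come close
  to at most half of the pairs of any translate, so the other half can still be used for sites later.
\<close>

definition has_sites :: "nat \<Rightarrow> nat \<Rightarrow> bool" where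
  "has_sites E n \<longleftrightarrow> (\<forall>A \<Omega>. spread (2 * E) A \<longrightarrow> card A = n \<longrightarrow> finite \<Omega> \<longrightarrow> \<Omega> \<subseteq> carrier G \<longrightarrow>
    (\<exists>S0 S1. S0 \<subseteq> \<Omega> \<and> S1 \<subseteq> \<Omega> \<and> S0 \<inter> S1 = {} \<and>
      (\<forall>x\<in>S0 \<union> S1. \<forall>y\<in>S0 \<union> S1. x \<noteq> y \<longrightarrow> gdist x y > E) \<and>
      (\<forall>s\<in>carrier G. n \<le> 2 * card {p \<in> A. fst p \<otimes> s \<in> \<Omega> \<and> snd p \<otimes> s \<in> \<Omega>} \<longrightarrow>
         (\<exists>p\<in>A. fst p \<otimes> s \<in> S0 \<and> snd p \<otimes> s \<in> S1)) \<and>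
      (\<forall>s\<in>carrier G. 2 * card {p \<in> A. \<exists>x\<in>S0 \<union> S1. gdist (fst p \<otimes> s) x \<le> E \<or> gdist (snd p \<otimes> s) x \<le> E} \<le> n)))"

text \<open>
  Sites are found by the local lemma. Each point of \<open>\<Omega>\<close> receives a random label below \<open>L\<close>; the labels \<open>0\<close> and
  \<open>1\<close> propose a site of the respective kind, and a proposal counts if no other proposal lies within \<open>E\<close>. The
  pairs of a translate of \<open>A\<close> depend on disjoint sets of labels (the blocks \<open>K s p\<close>), of bounded size. So
  the probability that a translate inside \<open>\<Omega>\<close> receives no complete pair decays exponentially with the
  number of pairs, and, since \<open>L\<close> is large, so does the probability that proposals are near to more than
  half of the pairs. Each label matters for a number of translates that is only linear in \<open>card A\<close>.
\<close>

theorem exists_has_sites: "\<exists>n\<ge>4. has_sites E n"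
proof -
  define \<beta> where "\<beta> = ball_card E"
  define L where "L = 64 * \<beta>"
  define u where "u = 1 - 1 / real L ^ (2 * \<beta>)"
  have \<beta>: "\<beta> \<ge> 1" and L: "L \<ge> 64" using ball_card_pos[of E] by (auto simp: \<beta>_def L_def)
  obtain m \<epsilon> where m: "m \<ge> 2" and \<epsilon>: "0 < \<epsilon>" "\<epsilon> < 1" and um: "2 * u ^ m < 1"
    "real (4 * m * \<beta>) * (2 * u ^ m) \<le> \<epsilon> * (1 - \<epsilon>) ^ (4 * \<beta> * m)"
    using local_lemma_parameters[of \<beta> L] \<beta> L unfolding u_def by auto
  have u: "1/4 \<le> u" "u < 1"
  proof -
    have "real L ^ 1 \<le> real L ^ (2 * \<beta>)" using L \<beta> by (intro power_increasing) auto
    moreover have "64 \<le> real L" using L by simp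
    ultimately have "real L ^ (2 * \<beta>) \<ge> 64" by (simp only: power_one_right)
    then have "1 / real L ^ (2 * \<beta>) \<le> 1 / 64"
      using L by (intro divide_left_mono) auto
    moreover have "0 < 1 / real L ^ (2 * \<beta>)" using L by simp
    ultimately have "0 < 1 / real L ^ (2 * \<beta>)" "1 / real L ^ (2 * \<beta>) \<le> 1 / 64" by blast+
    then show "1/4 \<le> u" "u < 1" unfolding u_def by linarith+
  qed
  show ?thesis
    unfolding has_sites_def
  proof (intro exI[of _ "2 * m"] conjI allI impI)
    show "4 \<le> 2 * m" using m by simp
    fix A \<Omega> assume A: "spread (2 * E) A" "card A = 2 * m" and \<Omega>: "finite \<Omega>" "\<Omega> \<subseteq> carrier G"
    have finA: "finite A" and AG: "\<And>p. p \<in> A \<Longrightarrow> fst p \<in> carrier G" "\<And>p. p \<in> A \<Longrightarrow> snd p \<in> carrier G"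
      using A by (auto simp: spread_def)
    define \<Lambda> where "\<Lambda> = {..<L}"
    have \<Lambda>01: "0 \<in> \<Lambda>" "1 \<in> \<Lambda>" "2 \<in> \<Lambda>" using L by (auto simp: \<Lambda>_def)
    then have \<Lambda>: "finite \<Lambda>" "\<Lambda> \<noteq> {}" "card \<Lambda> = L" "0 \<in> \<Lambda>" "1 \<in> \<Lambda>" "2 \<in> \<Lambda>"
      by (simp_all add: \<Lambda>_def) auto
    define K where "K s p = {x \<in> \<Omega>. gdist x (fst p \<otimes> s) \<le> E \<or> gdist x (snd p \<otimes> s) \<le> E}" for s p
    define dm where "dm s = (\<Union>p\<in>A. K s p)" for s
    define In where "In s = {p \<in> A. fst p \<otimes> s \<in> \<Omega> \<and> snd p \<otimes> s \<in> \<Omega>}" for s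
    define hit where "hit s p g \<longleftrightarrow> g (fst p \<otimes> s) = 0 \<and> g (snd p \<otimes> s) = 1 \<and>
        (\<forall>x\<in>K s p. x \<noteq> fst p \<otimes> s \<longrightarrow> x \<noteq> snd p \<otimes> s \<longrightarrow> g x \<ge> (2::nat))" for s p g
    \<comment> \<open>\<open>bad s\<close> concerns the translate of \<open>A\<close> by \<open>s\<close>; \<open>near\<close> counts all proposals, also the ones
      that do not become sites, so that it depends on a single block.\<close>
    define near where "near s p g \<longleftrightarrow> (\<exists>x\<in>K s p. g x < (2::nat))" for s p g
    define bad where "bad s g \<longleftrightarrow> (2 * m \<le> 2 * card (In s) \<and> (\<forall>p\<in>In s. \<not> hit s p (restrict g (K s p)))) \<or>
        (2 * m < 2 * card {p \<in> A. near s p (restrict g (K s p))})" for s g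
    define J where "J = {s \<in> carrier G. dm s \<noteq> {}}"
    have finK: "finite (K s p)" for s p using \<Omega> by (simp add: K_def)
    have Ksub: "K s p \<subseteq> dm s" if "p \<in> A" for s p using that by (auto simp: dm_def)
    have findm: "finite (dm s)" for s using finA finK by (auto simp: dm_def)
    have cK: "card (K s p) \<le> 2 * \<beta>" if "s \<in> carrier G" "p \<in> A" for s p
    proof -
      have "K s p \<subseteq> {x \<in> carrier G. gdist x (fst p \<otimes> s) \<le> E} \<union> {x \<in> carrier G. gdist x (snd p \<otimes> s) \<le> E}"
        using \<Omega> by (auto simp: K_def)
      then have "card (K s p) \<le> card ({x \<in> carrier G. gdist x (fst p \<otimes> s) \<le> E} \<union> {x \<in> carrier G. gdist x (snd p \<otimes> s) \<le> E})"
        using that AG[OF that(2)] finite_gdist by (intro card_mono) auto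
      also have "\<dots> \<le> card {x \<in> carrier G. gdist x (fst p \<otimes> s) \<le> E} + card {x \<in> carrier G. gdist x (snd p \<otimes> s) \<le> E}"
        by (rule card_Un_le)
      also have "\<dots> \<le> \<beta> + \<beta>" unfolding \<beta>_def using that AG[OF that(2)] by (intro add_mono card_gdist) auto
      finally show ?thesis by simp
    qed
    have disj: "disjoint_family_on (K s) A" if s: "s \<in> carrier G" for s
      unfolding disjoint_family_on_def
    proof (intro ballI impI)
      fix p q assume pq: "p \<in> A" "q \<in> A" "p \<noteq> q"
      show "K s p \<inter> K s q = {}"
      proof (rule ccontr)
        assume "K s p \<inter> K s q \<noteq> {}"
        then obtain x a b where x: "x \<in> \<Omega>" "a \<in> {fst p, snd p}" "b \<in> {fst q, snd q}"
          "gdist x (a \<otimes> s) \<le> E" "gdist x (b \<otimes> s) \<le> E" by (auto simp: K_def)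
        have G: "x \<in> carrier G" "a \<in> carrier G" "b \<in> carrier G" using x \<Omega> AG[OF pq(1)] AG[OF pq(2)] by auto
        have "gdist a b = gdist (a \<otimes> s) (b \<otimes> s)" using G s by simp
        also have "\<dots> \<le> gdist (a \<otimes> s) x + gdist x (b \<otimes> s)" using G s by (intro gdist_triangle) auto
        also have "gdist (a \<otimes> s) x = gdist x (a \<otimes> s)" using G s by (intro gdist_commute) auto
        finally have "gdist a b \<le> 2 * E" using x by simp
        moreover have "gdist a b > 2 * E" using A(1) pq x(2,3) unfolding spread_def by blast
        ultimately show False by simp
      qed
    qed
    have cdm: "card (dm s) \<le> 4 * \<beta> * m" if "s \<in> carrier G" for s
    proof -
      have "card (dm s) \<le> (\<Sum>p\<in>A. card (K s p))" unfolding dm_def by (rule card_UN_le[OF finA])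
      also have "\<dots> \<le> card A * (2 * \<beta>)" using sum_bounded_above[of A "\<lambda>p. card (K s p)" "2 * \<beta>"] cK that by simp
      finally show ?thesis using A by (simp add: algebra_simps)
    qed
    have degsub: "{s \<in> carrier G. v \<in> dm s} \<subseteq> (\<Union>p\<in>A. {s \<in> carrier G. gdist v (fst p \<otimes> s) \<le> E} \<union> {s \<in> carrier G. gdist v (snd p \<otimes> s) \<le> E})" for v
      by (auto simp: dm_def K_def)
    have finU: "finite (\<Union>p\<in>A. {s \<in> carrier G. gdist v (fst p \<otimes> s) \<le> E} \<union> {s \<in> carrier G. gdist v (snd p \<otimes> s) \<le> E})"
      if "v \<in> \<Omega>" for v using that \<Omega> finA AG finite_gdist_translates by blast
    have finJ: "finite J"
    proof -
      have "J = (\<Union>v\<in>\<Omega>. {s \<in> carrier G. v \<in> dm s})" by (auto simp: J_def dm_def K_def)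
      then show ?thesis using \<Omega> finite_subset[OF degsub finU] by auto
    qed
    have deg: "card {s \<in> J. v \<in> dm s} \<le> 4 * m * \<beta>" if "v \<in> \<Omega>" for v
    proof -
      have "{s \<in> J. v \<in> dm s} \<subseteq> {s \<in> carrier G. v \<in> dm s}" by (auto simp: J_def)
      then have "card {s \<in> J. v \<in> dm s} \<le> card (\<Union>p\<in>A. {s \<in> carrier G. gdist v (fst p \<otimes> s) \<le> E} \<union> {s \<in> carrier G. gdist v (snd p \<otimes> s) \<le> E})"
        using degsub[of v] finU[OF that] by (intro card_mono) auto
      also have "\<dots> \<le> (\<Sum>p\<in>A. card ({s \<in> carrier G. gdist v (fst p \<otimes> s) \<le> E} \<union> {s \<in> carrier G. gdist v (snd p \<otimes> s) \<le> E}))"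
        by (rule card_UN_le[OF finA])
      also have "\<dots> \<le> card A * (\<beta> + \<beta>)"
      proof -
        have "card ({s \<in> carrier G. gdist v (fst p \<otimes> s) \<le> E} \<union> {s \<in> carrier G. gdist v (snd p \<otimes> s) \<le> E}) \<le> \<beta> + \<beta>"
          if "p \<in> A" for p
          unfolding \<beta>_def using that AG[OF that] \<open>v \<in> \<Omega>\<close> \<Omega>
          by (intro order_trans[OF card_Un_le] add_mono card_gdist_translates) auto
        then show ?thesis using sum_bounded_above[of A _ "\<beta> + \<beta>"] by simp
      qed
      finally show ?thesis using A by (simp add: algebra_simps)
    qed
    have badle: "real (card {g \<in> dm s \<rightarrow>\<^sub>E \<Lambda>. bad s g}) \<le> (2 * u ^ m) * real (card \<Lambda>) ^ card (dm s)"
      if s: "s \<in> carrier G" for s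
    proof -
      let ?P = "dm s \<rightarrow>\<^sub>E \<Lambda>"
      have finP: "finite ?P" using findm \<Lambda> by (auto intro: finite_PiE)
      let ?B1 = "{g \<in> ?P. \<forall>p\<in>In s. \<not> hit s p (restrict g (K s p))}"
      let ?T = "{T \<in> Pow A. m \<le> card T}"
      let ?B2 = "\<lambda>T. {g \<in> ?P. \<forall>p\<in>T. near s p (restrict g (K s p))}"
      \<comment> \<open>One labelling of a block of at most \<open>2 * \<beta>\<close> points is a hit, which gives the factor \<open>u\<close>.\<close>
      have 1: "real (card ?B1) \<le> u ^ m * real L ^ card (dm s)" if "m \<le> card (In s)"
      proof -
        have "real (card ?B1) \<le> u ^ card (In s) * real (card \<Lambda>) ^ card (dm s)"
        proof (rule card_blocks_le)
          show "finite (In s)" using finA by (simp add: In_def)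
          show "disjoint_family_on (K s) (In s)" using disj[OF s] by (auto simp: In_def disjoint_family_on_def)
          fix p assume p: "p \<in> In s"
          then have pA: "p \<in> A" by (simp add: In_def)
          let ?h = "restrict ((\<lambda>_. 2)(fst p \<otimes> s := 0, snd p \<otimes> s := 1)) (K s p)"
          have cells: "fst p \<otimes> s \<in> K s p" "snd p \<otimes> s \<in> K s p" using p pA AG[OF pA] s by (auto simp: In_def K_def)
          have "gdist (fst p \<otimes> s) (snd p \<otimes> s) > 2 * E" using A(1) pA AG[OF pA] s by (auto simp: spread_def)
          then have "fst p \<otimes> s \<noteq> snd p \<otimes> s" using pA AG[OF pA] s by auto
          then have "hit s p ?h" using cells by (auto simp: hit_def)
          moreover have "?h \<in> K s p \<rightarrow>\<^sub>E \<Lambda>" using \<Lambda> by auto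
          ultimately have "{g \<in> K s p \<rightarrow>\<^sub>E \<Lambda>. \<not> hit s p g} \<subseteq> (K s p \<rightarrow>\<^sub>E \<Lambda>) - {?h}" by auto
          then have "card {g \<in> K s p \<rightarrow>\<^sub>E \<Lambda>. \<not> hit s p g} \<le> card ((K s p \<rightarrow>\<^sub>E \<Lambda>) - {?h})"
            using finK \<Lambda> by (intro card_mono finite_Diff finite_PiE) auto
          also have "\<dots> = L ^ card (K s p) - 1"
            using \<open>?h \<in> K s p \<rightarrow>\<^sub>E \<Lambda>\<close> finK \<Lambda> by (subst card_Diff_singleton) (auto simp: card_PiE)
          finally have "card {g \<in> K s p \<rightarrow>\<^sub>E \<Lambda>. \<not> hit s p g} \<le> L ^ card (K s p) - 1" .
          moreover have "L ^ card (K s p) \<ge> 1" using L by simp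
          ultimately have "real (card {g \<in> K s p \<rightarrow>\<^sub>E \<Lambda>. \<not> hit s p g}) \<le> real (L ^ card (K s p)) - 1"
            by linarith
          also have "\<dots> \<le> u * real L ^ card (K s p)"
          proof -
            have "real L ^ card (K s p) \<le> real L ^ (2 * \<beta>)" using cK[OF s pA] L by (intro power_increasing) auto
            then show ?thesis using L by (simp add: u_def field_simps)
          qed
          finally show "real (card {g \<in> K s p \<rightarrow>\<^sub>E \<Lambda>. \<not> hit s p g}) \<le> u * real (card \<Lambda>) ^ card (K s p)"
            using \<Lambda> by simp
        qed (use findm \<Lambda> u Ksub in \<open>auto simp: In_def\<close>)
        also have "\<dots> \<le> u ^ m * real (card \<Lambda>) ^ card (dm s)"
          using that u by (intro mult_right_mono power_decreasing) auto
        finally show ?thesis using \<Lambda> by simp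
      qed
      \<comment> \<open>\<open>T\<close> ranges over sets of at least \<open>m\<close> pairs near a proposal; there are at most \<open>4 ^ m\<close> of them,
      and by the choice \<open>L = 64 * \<beta>\<close> each pair contributes a factor \<open>1/16\<close>.\<close>
      have 2: "real (card (?B2 T)) \<le> (1/16) ^ m * real L ^ card (dm s)" if T: "T \<in> ?T" for T
      proof -
        have "real (card (?B2 T)) \<le> (1/16) ^ card T * real (card \<Lambda>) ^ card (dm s)"
        proof (rule card_blocks_le)
          show "finite T" using T finA finite_subset by auto
          show "K s i \<subseteq> dm s" if "i \<in> T" for i using Ksub[of i s] T that by blast
          show "disjoint_family_on (K s) T" using disj[OF s] T unfolding disjoint_family_on_def by blast
          fix p assume "p \<in> T"
          then have pA: "p \<in> A" using T by auto
          have "card {g \<in> K s p \<rightarrow>\<^sub>E \<Lambda>. g x < 2} \<le> 2 * L ^ (card (K s p) - 1)" if x: "x \<in> K s p" for x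
          proof -
            have "card {g \<in> K s p \<rightarrow>\<^sub>E \<Lambda>. (restrict g {x}) x < 2 \<and> True}
              \<le> card {g \<in> {x} \<rightarrow>\<^sub>E \<Lambda>. g x < 2} * card {h \<in> K s p - {x} \<rightarrow>\<^sub>E \<Lambda>. True}"
              using x finK \<Lambda> by (intro card_PiE_split[where P="\<lambda>g. g x < 2"]) auto
            also have "card {h \<in> K s p - {x} \<rightarrow>\<^sub>E \<Lambda>. True} = L ^ (card (K s p) - 1)"
              using finK x \<Lambda> by (simp add: card_PiE)
            also have "card {g \<in> {x} \<rightarrow>\<^sub>E \<Lambda>. g x < 2} \<le> card {..<2::nat}"
              by (rule card_inj_on_le[where f = "\<lambda>g. g x"])
                 (auto simp: inj_on_def intro!: PiE_ext[of _ "{x}" "\<lambda>_. \<Lambda>"])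
            finally show ?thesis by simp
          qed
          then have "(\<Sum>x\<in>K s p. card {g \<in> K s p \<rightarrow>\<^sub>E \<Lambda>. g x < 2}) \<le> card (K s p) * (2 * L ^ (card (K s p) - 1))"
            using sum_bounded_above[of "K s p" "\<lambda>x. card {g \<in> K s p \<rightarrow>\<^sub>E \<Lambda>. g x < 2}"] by simp
          moreover have "{g \<in> K s p \<rightarrow>\<^sub>E \<Lambda>. near s p g} = (\<Union>x\<in>K s p. {g \<in> K s p \<rightarrow>\<^sub>E \<Lambda>. g x < 2})"
            by (auto simp: near_def)
          ultimately have "card {g \<in> K s p \<rightarrow>\<^sub>E \<Lambda>. near s p g} \<le> card (K s p) * (2 * L ^ (card (K s p) - 1))"
            using card_UN_le[OF finK[of s p], of "\<lambda>x. {g \<in> K s p \<rightarrow>\<^sub>E \<Lambda>. g x < 2}"] by simp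
          also have "16 * \<dots> \<le> L ^ card (K s p)"
          proof (cases "card (K s p)")
            case (Suc k)
            then have "16 * (card (K s p) * 2) \<le> L" using cK[OF s pA] by (simp add: L_def)
            then have "16 * (card (K s p) * 2) * L ^ k \<le> L * L ^ k" by (rule mult_le_mono1)
            moreover have "16 * (card (K s p) * (2 * L ^ k)) = 16 * (card (K s p) * 2) * L ^ k" by simp
            ultimately show ?thesis unfolding Suc diff_Suc_1 power_Suc by (simp only:)
          qed simp
          finally have "real (16 * card {g \<in> K s p \<rightarrow>\<^sub>E \<Lambda>. near s p g}) \<le> real (L ^ card (K s p))"
            by (simp only: of_nat_le_iff)
          then show "real (card {g \<in> K s p \<rightarrow>\<^sub>E \<Lambda>. near s p g}) \<le> 1/16 * real (card \<Lambda>) ^ card (K s p)"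
            using \<Lambda> by simp
        qed (use findm \<Lambda> in auto)
        also have "\<dots> \<le> (1/16) ^ m * real (card \<Lambda>) ^ card (dm s)"
          using T by (intro mult_right_mono power_decreasing) auto
        finally show ?thesis using \<Lambda> by simp
      qed
      have finT: "finite ?T" using finA by simp
      have "card ?T \<le> card (Pow A)" using finA by (intro card_mono) auto
      then have cT: "card ?T \<le> 4 ^ m" using finA A by (simp add: card_Pow power_mult)
      have "(\<Sum>T\<in>?T. real (card (?B2 T))) \<le> real (card ?T) * ((1/16) ^ m * real L ^ card (dm s))"
        using sum_bounded_above[of ?T "\<lambda>T. real (card (?B2 T))"] 2 by simp
      also have "\<dots> \<le> 4 ^ m * ((1/16) ^ m * real L ^ card (dm s))"
      proof (rule mult_right_mono)
        show "real (card ?T) \<le> 4 ^ m" using cT by (metis of_nat_le_iff of_nat_numeral of_nat_power)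
      qed (use L in auto)
      also have "\<dots> = (1/4) ^ m * real L ^ card (dm s)"
      proof -
        have "(4::real) ^ m * (1/16) ^ m = (1/4) ^ m" by (simp flip: power_mult_distrib)
        then show ?thesis by (metis mult.assoc)
      qed
      also have "\<dots> \<le> u ^ m * real L ^ card (dm s)" using u by (intro mult_right_mono power_mono) auto
      finally have 3: "(\<Sum>T\<in>?T. real (card (?B2 T))) \<le> u ^ m * real L ^ card (dm s)" .
      have "real (card (\<Union>T\<in>?T. ?B2 T)) \<le> (\<Sum>T\<in>?T. real (card (?B2 T)))"
        using card_UN_le[OF finT, of ?B2] by (simp flip: of_nat_sum)
      then have 4: "real (card (\<Union>T\<in>?T. ?B2 T)) \<le> u ^ m * real L ^ card (dm s)" using 3 by linarith
      let ?B1' = "if m \<le> card (In s) then ?B1 else {}"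
      have 5: "real (card ?B1') \<le> u ^ m * real L ^ card (dm s)" using 1 u by auto
      have "{g \<in> ?P. bad s g} \<subseteq> ?B1' \<union> (\<Union>T\<in>?T. ?B2 T)"
      proof
        fix g assume g: "g \<in> {g \<in> ?P. bad s g}"
        show "g \<in> ?B1' \<union> (\<Union>T\<in>?T. ?B2 T)"
        proof (cases "2 * m < 2 * card {p \<in> A. near s p (restrict g (K s p))}")
          case True
          then have "{p \<in> A. near s p (restrict g (K s p))} \<in> ?T" by auto
          moreover have "g \<in> ?B2 {p \<in> A. near s p (restrict g (K s p))}" using g by auto
          ultimately show ?thesis by blast
        next
          case False
          then show ?thesis using g by (auto simp: bad_def)
        qed
      qed
      then have "card {g \<in> ?P. bad s g} \<le> card (?B1' \<union> (\<Union>T\<in>?T. ?B2 T))"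
        using finP finT by (intro card_mono) auto
      also have "\<dots> \<le> card ?B1' + card (\<Union>T\<in>?T. ?B2 T)" by (rule card_Un_le)
      finally have "real (card {g \<in> ?P. bad s g}) \<le> real (card ?B1') + real (card (\<Union>T\<in>?T. ?B2 T))"
        by (simp flip: of_nat_add)
      then show ?thesis using 4 5 \<Lambda> by simp
    qed
    have "\<exists>f \<in> \<Omega> \<rightarrow>\<^sub>E \<Lambda>. \<forall>s\<in>J. \<not> bad s (restrict f (dm s))"
    proof (rule local_lemma_counting[where k = "4 * m * \<beta>" and D = "4 * \<beta> * m" and p = "2 * u ^ m" and \<epsilon> = \<epsilon>])
      show "dm s \<subseteq> \<Omega>" for s by (auto simp: dm_def K_def)
    qed (use finJ \<Omega> \<Lambda> cdm badle deg \<epsilon> um u in \<open>auto simp: J_def\<close>)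
    then obtain f where f: "\<And>s. s \<in> J \<Longrightarrow> \<not> bad s (restrict f (dm s))" by auto
    define S where "S i = {x \<in> \<Omega>. f x = i \<and> (\<forall>z\<in>\<Omega>. z \<noteq> x \<longrightarrow> gdist x z \<le> E \<longrightarrow> f z \<ge> 2)}" for i
    have rr: "restrict (restrict f (dm s)) (K s p) = restrict f (K s p)" if "p \<in> A" for s p
      using Ksub[OF that] by (simp add: Int_absorb1)
    show "\<exists>S0 S1. S0 \<subseteq> \<Omega> \<and> S1 \<subseteq> \<Omega> \<and> S0 \<inter> S1 = {} \<and>
      (\<forall>x\<in>S0 \<union> S1. \<forall>y\<in>S0 \<union> S1. x \<noteq> y \<longrightarrow> gdist x y > E) \<and>
      (\<forall>s\<in>carrier G. 2 * m \<le> 2 * card {p \<in> A. fst p \<otimes> s \<in> \<Omega> \<and> snd p \<otimes> s \<in> \<Omega>} \<longrightarrow>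
         (\<exists>p\<in>A. fst p \<otimes> s \<in> S0 \<and> snd p \<otimes> s \<in> S1)) \<and>
      (\<forall>s\<in>carrier G. 2 * card {p \<in> A. \<exists>x\<in>S0 \<union> S1. gdist (fst p \<otimes> s) x \<le> E \<or> gdist (snd p \<otimes> s) x \<le> E} \<le> 2 * m)"
    proof (rule exI[of _ "S 0"], rule exI[of _ "S 1"], intro conjI ballI impI)
      show "S 0 \<subseteq> \<Omega>" "S 1 \<subseteq> \<Omega>" "S 0 \<inter> S 1 = {}" by (auto simp: S_def)
      show "E < gdist x y" if "x \<in> S 0 \<union> S 1" "y \<in> S 0 \<union> S 1" "x \<noteq> y" for x y
        using that by (force simp: S_def not_le[symmetric])
    next
      fix s assume s: "s \<in> carrier G" and n: "2 * m \<le> 2 * card {p \<in> A. fst p \<otimes> s \<in> \<Omega> \<and> snd p \<otimes> s \<in> \<Omega>}"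
      then have n': "2 * m \<le> 2 * card (In s)" by (simp add: In_def)
      then have "In s \<noteq> {}" using m by auto
      then obtain p where "p \<in> In s" by auto
      then have pA: "p \<in> A" by (simp add: In_def)
      then have "fst p \<otimes> s \<in> K s p" using \<open>p \<in> In s\<close> AG[OF pA] s by (auto simp: In_def K_def)
      then have "s \<in> J" using s pA by (auto simp: J_def dm_def)
      then obtain p where p: "p \<in> In s" "hit s p (restrict (restrict f (dm s)) (K s p))"
        using f n' unfolding bad_def by blast
      have pA: "p \<in> A" using p by (simp add: In_def)
      have h: "hit s p (restrict f (K s p))" using p(2) rr[OF pA] by (simp del: restrict_restrict)
      have cells: "fst p \<otimes> s \<in> K s p" "snd p \<otimes> s \<in> K s p" using p pA AG[OF pA] s by (auto simp: In_def K_def)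
      have far: "gdist (fst p \<otimes> s) (snd p \<otimes> s) > 2 * E" using A(1) pA AG[OF pA] s by (auto simp: spread_def)
      have far': "gdist (snd p \<otimes> s) (fst p \<otimes> s) > 2 * E" using far pA AG[OF pA] s gdist_commute by simp
      have c1: "c = 0 \<or> c = 1 \<Longrightarrow> x \<in> K s p" if "x \<in> \<Omega>" "gdist ((if c = 0 then fst p else snd p) \<otimes> s) x \<le> E" for x and c :: nat
        using that gdist_commute[of x "fst p \<otimes> s"] gdist_commute[of x "snd p \<otimes> s"] pA AG[OF pA] s \<Omega>
        by (auto simp: K_def split: if_splits)
      have "fst p \<otimes> s \<in> S 0"
        unfolding S_def
      proof (intro CollectI conjI ballI impI)
        show "fst p \<otimes> s \<in> \<Omega>" using p by (simp add: In_def)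
        show "f (fst p \<otimes> s) = 0" using h cells by (simp add: hit_def)
        fix z assume z: "z \<in> \<Omega>" "z \<noteq> fst p \<otimes> s" "gdist (fst p \<otimes> s) z \<le> E"
        have "z \<in> K s p" using c1[of z 0] z by simp
        moreover have "z \<noteq> snd p \<otimes> s" using z far by auto
        ultimately show "2 \<le> f z" using h z by (auto simp: hit_def)
      qed
      moreover have "snd p \<otimes> s \<in> S 1"
        unfolding S_def
      proof (intro CollectI conjI ballI impI)
        show "snd p \<otimes> s \<in> \<Omega>" using p by (simp add: In_def)
        show "f (snd p \<otimes> s) = 1" using h cells by (simp add: hit_def)
        fix z assume z: "z \<in> \<Omega>" "z \<noteq> snd p \<otimes> s" "gdist (snd p \<otimes> s) z \<le> E"
        have "z \<in> K s p" using c1[of z 1] z by simp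
        moreover have "z \<noteq> fst p \<otimes> s" using z far' by auto
        ultimately show "2 \<le> f z" using h z by (auto simp: hit_def)
      qed
      ultimately show "\<exists>p\<in>A. fst p \<otimes> s \<in> S 0 \<and> snd p \<otimes> s \<in> S 1" using pA by blast
    next
      fix s assume s: "s \<in> carrier G"
      have sub: "{p \<in> A. \<exists>x\<in>S 0 \<union> S 1. gdist (fst p \<otimes> s) x \<le> E \<or> gdist (snd p \<otimes> s) x \<le> E}
          \<subseteq> {p \<in> A. near s p (restrict f (K s p))}" (is "?N \<subseteq> ?N'")
      proof (intro subsetI CollectI conjI)
        fix p assume p: "p \<in> ?N"
        then show "p \<in> A" by simp
        obtain x where x: "x \<in> S 0 \<union> S 1" "gdist (fst p \<otimes> s) x \<le> E \<or> gdist (snd p \<otimes> s) x \<le> E" using p by auto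
        then have "x \<in> \<Omega>" "f x < 2" by (auto simp: S_def)
        moreover have "x \<in> K s p"
          using x \<open>x \<in> \<Omega>\<close> gdist_commute[of x "fst p \<otimes> s"] gdist_commute[of x "snd p \<otimes> s"] AG[OF \<open>p \<in> A\<close>] s \<Omega>
          by (auto simp: K_def)
        ultimately show "near s p (restrict f (K s p))" by (auto simp: near_def)
      qed
      show "2 * card ?N \<le> 2 * m"
      proof (cases "s \<in> J")
        case True
        have "\<not> 2 * m < 2 * card {p \<in> A. near s p (restrict (restrict f (dm s)) (K s p))}"
          using f[OF True] unfolding bad_def by blast
        moreover have "{p \<in> A. near s p (restrict (restrict f (dm s)) (K s p))} = ?N'"
          using rr by (auto simp del: restrict_restrict)
        moreover have "card ?N \<le> card ?N'" using sub finA by (intro card_mono) auto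
        ultimately show ?thesis by simp
      next
        case False
        then have "?N' = {}" using s by (auto simp: J_def dm_def near_def)
        then have "?N = {}" using sub by blast
        then show ?thesis by (simp only: card.empty)
      qed
    qed
  qed
qed

end

context length_group begin

section \<open>Patches and patch systems\<close>

definition translate :: "('g \<rightharpoonup> bool) \<Rightarrow> 'g \<Rightarrow> 'g \<rightharpoonup> bool" where
  "translate q s = (\<lambda>x. if x \<in> carrier G then q (x \<otimes> inv s) else None)"

lemma dom_translate: "dom (translate q s) = {x \<in> carrier G. x \<otimes> inv s \<in> dom q}"
  by (auto simp: translate_def split: if_splits)

lemma finite_dom_translate:
  assumes "finite (dom q)" "s \<in> carrier G"
  shows "finite (dom (translate q s))"
proof -
  have "dom (translate q s) \<subseteq> (\<lambda>y. y \<otimes> s) ` dom q"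
  proof
    fix x assume "x \<in> dom (translate q s)"
    then have x: "x \<in> carrier G" "x \<otimes> inv s \<in> dom q" by (auto simp: dom_translate)
    then have "x = (x \<otimes> inv s) \<otimes> s" using assms by (simp add: m_assoc)
    then show "x \<in> (\<lambda>y. y \<otimes> s) ` dom q" using x by blast
  qed
  then show ?thesis using assms(1) finite_surj by blast
qed

lemma translate_translate:
  assumes "s \<in> carrier G" "t \<in> carrier G"
  shows "translate (translate q s) t = translate q (s \<otimes> t)"
proof
  fix x
  show "translate (translate q s) t x = translate q (s \<otimes> t) x"
    using assms by (auto simp: translate_def inv_mult_group m_assoc)
qed

lemma translate_mono: "q \<subseteq>\<^sub>m q' \<Longrightarrow> translate q s \<subseteq>\<^sub>m translate q' s"
  by (auto simp: map_le_def translate_def dom_def split: if_splits)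

definition nbhd :: "nat \<Rightarrow> 'g set \<Rightarrow> 'g set" where
  "nbhd r B = {x \<in> carrier G. \<exists>y\<in>B. gdist x y \<le> r}"

lemma finite_nbhd: "finite B \<Longrightarrow> B \<subseteq> carrier G \<Longrightarrow> finite (nbhd r B)"
proof -
  assume B: "finite B" "B \<subseteq> carrier G"
  have "nbhd r B = (\<Union>y\<in>B. {x \<in> carrier G. gdist x y \<le> r})" by (auto simp: nbhd_def)
  then show ?thesis using B finite_gdist by auto
qed

lemma nbhd_subset_carrier: "nbhd r B \<subseteq> carrier G"
  by (auto simp: nbhd_def)

lemma gdist_le_len: "x \<in> carrier G \<Longrightarrow> y \<in> carrier G \<Longrightarrow> gdist x y \<le> len x + len y"
  using len_mult[of x "inv y"] len_inv[of y] by (simp add: gdist_def)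

lemma len_le_gdist: "x \<in> carrier G \<Longrightarrow> y \<in> carrier G \<Longrightarrow> len x \<le> gdist x y + len y"
  using gdist_triangle[of x y \<one>] by (simp add: gdist_one)

text \<open>
  Just enough to choose, one after the other, any number of pairs from \<open>I\<close> all of whose coordinates are far
  from each other.
\<close>

definition escaping :: "('g \<times> 'g) set \<Rightarrow> bool" where
  "escaping I \<longleftrightarrow> I \<subseteq> carrier G \<times> carrier G \<and> (\<forall>r. \<exists>(a, b)\<in>I. len a > r \<and> len b > r \<and> gdist a b > r)"

lemma exists_spread:
  assumes "escaping I"
  shows "\<exists>A\<subseteq>I. spread r A \<and> card A = n"
proof (induction n)
  case 0
  show ?case by (rule exI[of _ "{}"]) (simp add: spread_def)
next
  case (Suc n)
  then obtain A where A: "A \<subseteq> I" "spread r A" "card A = n" by auto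
  have finA: "finite A" and AG: "A \<subseteq> carrier G \<times> carrier G" using A(2) by (auto simp: spread_def)
  define M where "M = (\<Sum>p\<in>A. len (fst p) + len (snd p))"
  have M: "len x \<le> M" if "p \<in> A" "x \<in> {fst p, snd p}" for p x
  proof -
    have "len (fst p) + len (snd p) \<le> M" unfolding M_def using finA that(1)
      by (intro member_le_sum) auto
    then show ?thesis using that(2) by auto
  qed
  obtain a b where ab: "(a, b) \<in> I" "len a > M + r" "len b > M + r" "gdist a b > M + r"
    using assms unfolding escaping_def by blast
  have abG: "a \<in> carrier G" "b \<in> carrier G" using ab(1) assms by (auto simp: escaping_def)
  have far: "gdist x y > r" "gdist y x > r" if "p \<in> A" "x \<in> {fst p, snd p}" "y \<in> {a, b}" for p x y
  proof -
    have G: "x \<in> carrier G" "y \<in> carrier G" using that AG abG by auto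
    have "len y \<le> gdist y x + len x" using G by (intro len_le_gdist)
    moreover have "len x \<le> M" using M that by blast
    moreover have "len y > M + r" using that ab by auto
    ultimately show "gdist y x > r" by linarith
    then show "gdist x y > r" using G by (simp add: gdist_commute)
  qed
  have new: "(a, b) \<notin> A"
  proof
    assume "(a, b) \<in> A"
    then have "len a \<le> M" using M[of "(a, b)" a] by simp
    then show False using ab by simp
  qed
  have "spread r (insert (a, b) A)"
    unfolding spread_def
  proof (intro conjI ballI impI)
    show "finite (insert (a, b) A)" using finA by simp
    show "insert (a, b) A \<subseteq> carrier G \<times> carrier G" using AG abG by auto
    show "r < gdist (fst p) (snd p)" if "p \<in> insert (a, b) A" for p
      using that ab A(2) by (auto simp: spread_def)
    fix p q x y assume pq: "p \<in> insert (a, b) A" "q \<in> insert (a, b) A" "p \<noteq> q"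
      "x \<in> {fst p, snd p}" "y \<in> {fst q, snd q}"
    show "r < gdist x y"
    proof (cases "p \<in> A \<and> q \<in> A")
      case True
      then show ?thesis using A(2) pq unfolding spread_def by blast
    next
      case False
      then show ?thesis using pq far(1)[of p x y] far(2)[of q y x] by auto
    qed
  qed
  moreover have "card (insert (a, b) A) = Suc n" using finA new A by simp
  ultimately show ?case using A ab by blast
qed

text \<open>
  A patch is a finite partial configuration. A patch system is a class \<open>P\<close> of patches that can be glued at
  distances above \<open>R\<close> and extended over any finite set \<open>V\<close> around them. The extension stays within \<open>R\<close> of
  \<open>V\<close>: when sites are placed around \<open>V\<close>, this tells which of them an extension can touch. That all patches
  with at most two points belong to \<open>P\<close> makes \<open>P\<close> nonempty and provides the patterns that witness freeness.
\<close>

definition patch_system :: "(('g \<rightharpoonup> bool) \<Rightarrow> bool) \<Rightarrow> nat \<Rightarrow> bool" where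
  "patch_system P R \<longleftrightarrow>
     (\<forall>q. P q \<longrightarrow> finite (dom q) \<and> dom q \<subseteq> carrier G) \<and>
     (\<forall>q. finite (dom q) \<longrightarrow> dom q \<subseteq> carrier G \<longrightarrow> card (dom q) \<le> 2 \<longrightarrow> P q) \<and>
     (\<forall>q s. P q \<longrightarrow> s \<in> carrier G \<longrightarrow> P (translate q s)) \<and>
     (\<forall>q q'. P q \<longrightarrow> P q' \<longrightarrow> (\<forall>x\<in>dom q. \<forall>y\<in>dom q'. gdist x y > R) \<longrightarrow> P (q ++ q')) \<and>
     (\<forall>q V. P q \<longrightarrow> finite V \<longrightarrow> V \<subseteq> carrier G \<longrightarrow> nbhd R (dom q) \<subseteq> V \<longrightarrow>
        (\<exists>q'. P q' \<and> q \<subseteq>\<^sub>m q' \<and> V \<subseteq> dom q' \<and> dom q' \<subseteq> nbhd R V))"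

lemma
  assumes sys: "patch_system P R"
  shows patch_finite: "P q \<Longrightarrow> finite (dom q)"
    and patch_carrier: "P q \<Longrightarrow> dom q \<subseteq> carrier G"
    and patch_small: "finite (dom q) \<Longrightarrow> dom q \<subseteq> carrier G \<Longrightarrow> card (dom q) \<le> 2 \<Longrightarrow> P q"
    and patch_translate: "P q \<Longrightarrow> s \<in> carrier G \<Longrightarrow> P (translate q s)"
    and patch_glue: "P q \<Longrightarrow> P q' \<Longrightarrow> (\<And>x y. x \<in> dom q \<Longrightarrow> y \<in> dom q' \<Longrightarrow> gdist x y > R) \<Longrightarrow> P (q ++ q')"
    and patch_extend: "P q \<Longrightarrow> finite V \<Longrightarrow> V \<subseteq> carrier G \<Longrightarrow> nbhd R (dom q) \<subseteq> V \<Longrightarrow>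
        \<exists>q'. P q' \<and> q \<subseteq>\<^sub>m q' \<and> V \<subseteq> dom q' \<and> dom q' \<subseteq> nbhd R V"
proof -
  note s = sys[unfolded patch_system_def]
  note s1 = s[THEN conjunct1] and s2 = s[THEN conjunct2, THEN conjunct1]
    and s3 = s[THEN conjunct2, THEN conjunct2, THEN conjunct1]
    and s4 = s[THEN conjunct2, THEN conjunct2, THEN conjunct2, THEN conjunct1]
    and s5 = s[THEN conjunct2, THEN conjunct2, THEN conjunct2, THEN conjunct2]
  show "P q \<Longrightarrow> finite (dom q)" "P q \<Longrightarrow> dom q \<subseteq> carrier G" using s1 by blast+
  show "finite (dom q) \<Longrightarrow> dom q \<subseteq> carrier G \<Longrightarrow> card (dom q) \<le> 2 \<Longrightarrow> P q" using s2 by blast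
  show "P q \<Longrightarrow> s \<in> carrier G \<Longrightarrow> P (translate q s)" using s3 by blast
  show "P q \<Longrightarrow> P q' \<Longrightarrow> (\<And>x y. x \<in> dom q \<Longrightarrow> y \<in> dom q' \<Longrightarrow> gdist x y > R) \<Longrightarrow> P (q ++ q')"
    using s4[rule_format, of q q'] by blast
  show "P q \<Longrightarrow> finite V \<Longrightarrow> V \<subseteq> carrier G \<Longrightarrow> nbhd R (dom q) \<subseteq> V \<Longrightarrow>
        \<exists>q'. P q' \<and> q \<subseteq>\<^sub>m q' \<and> V \<subseteq> dom q' \<and> dom q' \<subseteq> nbhd R V"
    using s5[rule_format, of q V] by blast
qed

lemma patch_system_full: "patch_system (\<lambda>q. finite (dom q) \<and> dom q \<subseteq> carrier G) 0"
proof -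
  have 1: "\<exists>q'. (finite (dom q') \<and> dom q' \<subseteq> carrier G) \<and> q \<subseteq>\<^sub>m q' \<and> V \<subseteq> dom q' \<and> dom q' \<subseteq> nbhd 0 V"
    if "finite V" "V \<subseteq> carrier G" "nbhd 0 (dom q) \<subseteq> V" "dom q \<subseteq> carrier G" for q :: "'g \<rightharpoonup> bool" and V
  proof -
    have self: "B \<subseteq> nbhd 0 B" if "B \<subseteq> carrier G" for B
    proof
      fix x assume "x \<in> B"
      then have "x \<in> carrier G" "gdist x x \<le> 0" using that by auto
      then show "x \<in> nbhd 0 B" using \<open>x \<in> B\<close> unfolding nbhd_def by blast
    qed
    have sub: "dom q \<subseteq> V" using self[OF that(4)] that(3) by (rule order_trans)
    let ?q' = "(\<lambda>x. if x \<in> V then Some False else None) ++ q"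
    have "dom (\<lambda>x. if x \<in> V then Some False else None) = V" by (auto split: if_splits)
    then have "dom ?q' = V" using sub by (simp only: dom_map_add) blast
    then show ?thesis using that self[OF that(2)] by (intro exI[of _ ?q']) simp
  qed
  have 2: "finite (dom (translate q s)) \<and> dom (translate q s) \<subseteq> carrier G"
    if "finite (dom q)" "s \<in> carrier G" for q s
    using finite_dom_translate[OF that] by (auto simp: dom_translate)
  show ?thesis
    unfolding patch_system_def
  proof (intro conjI allI impI)
    fix q :: "'g \<rightharpoonup> bool" and V assume "finite (dom q) \<and> dom q \<subseteq> carrier G" "finite V" "V \<subseteq> carrier G" "nbhd 0 (dom q) \<subseteq> V"
    then show "\<exists>q'. (finite (dom q') \<and> dom q' \<subseteq> carrier G) \<and> q \<subseteq>\<^sub>m q' \<and> V \<subseteq> dom q' \<and> dom q' \<subseteq> nbhd 0 V"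
      using 1[of V q] by blast
  next
    fix q :: "'g \<rightharpoonup> bool" and s assume "finite (dom q) \<and> dom q \<subseteq> carrier G" "s \<in> carrier G"
    then show "finite (dom (translate q s))" "dom (translate q s) \<subseteq> carrier G" using 2[of q s] by blast+
  qed simp_all
qed

lemma patch_glue_disjoint:
  assumes "\<And>x y. x \<in> dom q \<Longrightarrow> y \<in> dom q' \<Longrightarrow> gdist x y > (r::nat)" "dom q \<subseteq> carrier G"
  shows "q \<subseteq>\<^sub>m q ++ q'" "q' \<subseteq>\<^sub>m q ++ q'"
proof -
  have "dom q \<inter> dom q' = {}"
  proof (rule ccontr)
    assume "dom q \<inter> dom q' \<noteq> {}"
    then obtain x where "x \<in> dom q" "x \<in> dom q'" by blast
    then show False using assms(1)[of x x] assms(2) by auto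
  qed
  then show "q \<subseteq>\<^sub>m q ++ q'" by (metis map_add_comm map_le_map_add)
  show "q' \<subseteq>\<^sub>m q ++ q'" by simp
qed

lemma gdist_dom_translate:
  assumes "\<And>x. x \<in> dom q \<Longrightarrow> len x \<le> \<rho>" "x \<in> dom (translate q s)" "s \<in> carrier G"
  shows "x \<in> carrier G" "gdist x s \<le> \<rho>"
  using assms by (auto simp: dom_translate gdist_def)

text \<open>
  Gluing is applied once for each site; a patch of radius \<open>\<rho>\<close> at a site uses up \<open>\<rho>\<close> of the distance on
  either side.
\<close>

lemma patch_glue_sites:
  assumes sys: "patch_system P R" and "finite S" "S \<subseteq> carrier G" "P q"
    and l: "\<And>s. s \<in> S \<Longrightarrow> P (l s)" and \<rho>: "\<And>s x. s \<in> S \<Longrightarrow> x \<in> dom (l s) \<Longrightarrow> len x \<le> \<rho>"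
    and sep: "\<And>s s'. s \<in> S \<Longrightarrow> s' \<in> S \<Longrightarrow> s \<noteq> s' \<Longrightarrow> gdist s s' > R + 2 * \<rho>"
    and far: "\<And>s x. s \<in> S \<Longrightarrow> x \<in> dom q \<Longrightarrow> gdist s x > R + \<rho>"
  shows "\<exists>q'. P q' \<and> q \<subseteq>\<^sub>m q' \<and> (\<forall>s\<in>S. translate (l s) s \<subseteq>\<^sub>m q') \<and> dom q' \<subseteq> dom q \<union> nbhd \<rho> S"
  using assms(2,3) l \<rho> sep far
proof (induction S rule: finite_induct)
  case empty
  then show ?case using \<open>P q\<close> by (intro exI[of _ q]) auto
next
  case (insert s S)
  have "\<exists>q'. P q' \<and> q \<subseteq>\<^sub>m q' \<and> (\<forall>s\<in>S. translate (l s) s \<subseteq>\<^sub>m q') \<and> dom q' \<subseteq> dom q \<union> nbhd \<rho> S"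
    using insert.prems by (intro insert.IH) auto
  then obtain q' where q': "P q'" "q \<subseteq>\<^sub>m q'" "\<And>s. s \<in> S \<Longrightarrow> translate (l s) s \<subseteq>\<^sub>m q'" "dom q' \<subseteq> dom q \<union> nbhd \<rho> S"
    by blast
  have sG: "s \<in> carrier G" "S \<subseteq> carrier G" using insert.prems by auto
  let ?t = "translate (l s) s"
  have dt: "y \<in> carrier G" "gdist y s \<le> \<rho>" if "y \<in> dom ?t" for y
    using gdist_dom_translate[of "l s" \<rho> y s] that insert.prems(3)[of s] sG by auto
  have apart: "gdist x y > R" if xy: "x \<in> dom q'" "y \<in> dom ?t" for x y
  proof -
    have xG: "x \<in> carrier G" using patch_carrier[OF sys q'(1)] xy(1) by blast
    have tri: "gdist s x \<le> gdist s y + gdist y x" using xG sG dt[OF xy(2)] by (intro gdist_triangle) auto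
    have sy: "gdist s y \<le> \<rho>" using dt[OF xy(2)] sG gdist_commute by metis
    have yx: "gdist y x = gdist x y" using xG dt[OF xy(2)] gdist_commute by metis
    consider "x \<in> dom q" | "x \<in> nbhd \<rho> S" using q'(4) xy(1) by blast
    then have "gdist s x > R + \<rho>"
    proof cases
      case 1
      then show ?thesis using insert.prems(5) by auto
    next
      case 2
      then obtain s' where s': "s' \<in> S" "gdist x s' \<le> \<rho>" by (auto simp: nbhd_def)
      then have "gdist s s' > R + 2 * \<rho>" using insert.prems(4)[of s s'] insert.hyps by auto
      moreover have "gdist s s' \<le> gdist s x + gdist x s'" using sG s' xG by (intro gdist_triangle) auto
      ultimately show ?thesis using s' by linarith
    qed
    then show ?thesis using tri sy yx by linarith
  qed
  have "P (q' ++ ?t)"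
    using q'(1) patch_translate[OF sys insert.prems(2)[of s]] sG apart by (intro patch_glue[OF sys]) auto
  moreover have le: "q' \<subseteq>\<^sub>m q' ++ ?t" "?t \<subseteq>\<^sub>m q' ++ ?t"
    using patch_glue_disjoint[of q' ?t R, OF apart patch_carrier[OF sys q'(1)]] by auto
  moreover have "q \<subseteq>\<^sub>m q' ++ ?t" using q'(2) le(1) by (rule map_le_trans)
  moreover have "\<forall>s'\<in>insert s S. translate (l s') s' \<subseteq>\<^sub>m q' ++ ?t"
    using q'(3) le map_le_trans by blast
  moreover have "dom (q' ++ ?t) \<subseteq> dom q \<union> nbhd \<rho> (insert s S)"
  proof -
    have "dom ?t \<subseteq> nbhd \<rho> (insert s S)" using dt unfolding nbhd_def by blast
    moreover have "nbhd \<rho> S \<subseteq> nbhd \<rho> (insert s S)" by (auto simp: nbhd_def)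
    ultimately show ?thesis using q'(4) by (simp only: dom_map_add) blast
  qed
  ultimately show ?case by blast
qed

end

context length_group begin

section \<open>Forcing occurrences of a pattern\<close>

text \<open>
  A patch system can be thinned out so that every patch that covers a certain finite window \<open>W\<close> contains
  \<open>p0\<close> at \<open>fst p\<close> and \<open>p1\<close> at \<open>snd p\<close> for some pair \<open>p\<close> in \<open>I\<close>. Choose a long list \<open>A\<close> of widely spaced pairs from \<open>I\<close>
  and keep the patches for which every translate of \<open>A\<close> either contains such an occurrence already (\<open>sat\<close>) or
  has at least half of its pairs far from the domain of the patch (\<open>avail\<close>).

  Such patches can be extended over \<open>V\<close>. Let \<open>\<Omega>\<close> be a neighbourhood of \<open>V\<close>, large in comparison with the
  diameter of \<open>A\<close>, without the points near the old patch. Place \<open>p0\<close> and \<open>p1\<close> at sites in \<open>\<Omega>\<close> and extend the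
  result in the old system. A translate of \<open>A\<close> that comes near \<open>V\<close> lies within the neighbourhood, so its
  available pairs lie in \<open>\<Omega>\<close> and it is hit by sites. A translate that stays away from \<open>V\<close> comes near the new patch
  only at sites, so at most half of its pairs become unavailable.
\<close>

theorem patch_system_step:
  assumes sys: "patch_system P R" and p0: "P p0" and p1: "P p1" and I: "escaping I"
  shows "\<exists>P' R' W. patch_system P' R' \<and> (\<forall>q. P' q \<longrightarrow> P q) \<and> finite W \<and> W \<subseteq> carrier G \<and>
    (\<forall>q. P' q \<longrightarrow> W \<subseteq> dom q \<longrightarrow>
      (\<exists>p\<in>I. translate p0 (fst p) \<subseteq>\<^sub>m q |` W \<and> translate p1 (snd p) \<subseteq>\<^sub>m q |` W))"
proof -
  have "finite (len ` (dom p0 \<union> dom p1))" using patch_finite[OF sys] p0 p1 by auto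
  then obtain \<rho> where "\<And>x. x \<in> len ` (dom p0 \<union> dom p1) \<Longrightarrow> x \<le> \<rho>" by (meson finite_nat_set_iff_bounded_le)
  then have \<rho>: "x \<in> dom p0 \<or> x \<in> dom p1 \<Longrightarrow> len x \<le> \<rho>" for x by blast
  \<comment> \<open>At a distance above \<open>N\<close> from a patch, \<open>p0\<close> and \<open>p1\<close> can be glued to it. The distance \<open>E\<close> between sites
    leaves room for gluing, and a point farther than \<open>E\<close> from all sites is still farther than \<open>N\<close> from the
    extension of the patches at the sites, which reaches \<open>2 * R + \<rho>\<close> beyond them.\<close>
  define N where "N = R + \<rho>"
  define E where "E = 3 * R + 2 * \<rho>"
  obtain n where n: "n \<ge> 4" and sites_n: "has_sites E n"
    using exists_has_sites[of E] by blast
  obtain A where A: "A \<subseteq> I" "spread (2 * E) A" "card A = n" using exists_spread[OF I] by blast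
  have finA: "finite A" and AG: "\<And>p. p \<in> A \<Longrightarrow> fst p \<in> carrier G \<and> snd p \<in> carrier G"
    using A(2) by (auto simp: spread_def)
  define \<Delta> where "\<Delta> = 2 * (\<Sum>p\<in>A. len (fst p) + len (snd p))"
  have \<Delta>: "gdist (a \<otimes> s) (b \<otimes> s) \<le> \<Delta>"
    if "p \<in> A" "q \<in> A" "a \<in> {fst p, snd p}" "b \<in> {fst q, snd q}" "s \<in> carrier G" for p q a b s
  proof -
    have *: "len x \<le> (\<Sum>p\<in>A. len (fst p) + len (snd p))" if "r \<in> A" "x \<in> {fst r, snd r}" for r x
    proof -
      have "len x \<le> len (fst r) + len (snd r)" using that by auto
      also have "\<dots> \<le> (\<Sum>p\<in>A. len (fst p) + len (snd p))"
        using that(1) finA by (intro member_le_sum) auto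
      finally show ?thesis .
    qed
    have G: "a \<in> carrier G" "b \<in> carrier G" using that AG[of p] AG[of q] by auto
    then have "gdist (a \<otimes> s) (b \<otimes> s) \<le> len a + len b" using that by (simp add: gdist_le_len)
    then show ?thesis using *[OF that(1,3)] *[OF that(2,4)] by (simp add: \<Delta>_def)
  qed
  define R' where "R' = 4 * R + 4 * \<rho> + 2 * N + 2 * \<Delta>"
  define sat where "sat q s \<longleftrightarrow> (\<exists>p\<in>A. translate p0 (fst p \<otimes> s) \<subseteq>\<^sub>m q \<and> translate p1 (snd p \<otimes> s) \<subseteq>\<^sub>m q)" for q s
  define avail where "avail q s p \<longleftrightarrow> (\<forall>x\<in>dom q. gdist (fst p \<otimes> s) x > N \<and> gdist (snd p \<otimes> s) x > N)" for q :: "'g \<rightharpoonup> bool" and s p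
  define P' where "P' q \<longleftrightarrow> P q \<and> (\<forall>s\<in>carrier G. sat q s \<or> n \<le> 2 * card {p \<in> A. avail q s p})" for q
  define W where "W = (\<Union>p\<in>A. {fst p, snd p} \<union> dom (translate p0 (fst p)) \<union> dom (translate p1 (snd p)))"
  have sat_mono: "sat q s \<Longrightarrow> q \<subseteq>\<^sub>m q' \<Longrightarrow> sat q' s" for q q' s
    unfolding sat_def using map_le_trans by blast
  have subA: "card {p \<in> A. Q p} \<le> card {p \<in> A. Q' p}" if "\<And>p. p \<in> A \<Longrightarrow> Q p \<Longrightarrow> Q' p" for Q Q'
    using that finA by (intro card_mono) auto
  have near_all: "gdist x b' \<le> N + \<Delta>"
    if "p \<in> A" "p' \<in> A" "a \<in> {fst p, snd p}" "b \<in> {fst p', snd p'}" "s \<in> carrier G" "x \<in> carrier G"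
      "gdist (a \<otimes> s) x \<le> N" "b' = b \<otimes> s" for p p' a b b' s x
  proof -
    have G: "a \<in> carrier G" "b \<in> carrier G" using that AG[of p] AG[of p'] by auto
    have "gdist x b' \<le> gdist x (a \<otimes> s) + gdist (a \<otimes> s) (b \<otimes> s)" unfolding that(8) using G that by (intro gdist_triangle) auto
    moreover have "gdist x (a \<otimes> s) = gdist (a \<otimes> s) x" using G that by (intro gdist_commute) auto
    ultimately show ?thesis using \<Delta>[OF that(1-5)] that(7) by linarith
  qed
  \<comment> \<open>A point is near at most one pair of a translate, so two points spoil at most two of the \<open>n \<ge> 4\<close> pairs.\<close>
  have small: "P' q" if q: "finite (dom q)" "dom q \<subseteq> carrier G" "card (dom q) \<le> 2" for q
    unfolding P'_def
  proof (intro conjI ballI disjI2)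
    show "P q" using patch_small[OF sys] q by blast
    fix s assume s: "s \<in> carrier G"
    define C where "C x = {p \<in> A. gdist (fst p \<otimes> s) x \<le> N \<or> gdist (snd p \<otimes> s) x \<le> N}" for x
    have "card (C x) \<le> 1" if x: "x \<in> dom q" for x
    proof -
      have "p = p'" if pp: "p \<in> C x" "p' \<in> C x" for p p'
      proof (rule ccontr)
        assume ne: "p \<noteq> p'"
        have xG: "x \<in> carrier G" using q x by blast
        obtain a b where ab: "a \<in> {fst p, snd p}" "b \<in> {fst p', snd p'}" "gdist (a \<otimes> s) x \<le> N" "gdist (b \<otimes> s) x \<le> N"
          "p \<in> A" "p' \<in> A"
          using pp by (auto simp: C_def)
        have G: "a \<in> carrier G" "b \<in> carrier G" using ab AG[of p] AG[of p'] by auto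
        have "gdist a b = gdist (a \<otimes> s) (b \<otimes> s)" using G s by simp
        also have "\<dots> \<le> gdist (a \<otimes> s) x + gdist x (b \<otimes> s)" using G s xG by (intro gdist_triangle) auto
        also have "gdist x (b \<otimes> s) = gdist (b \<otimes> s) x" using G s xG by (intro gdist_commute) auto
        finally have "gdist a b \<le> 2 * E" using ab(3,4) by (simp add: N_def E_def)
        moreover have "gdist a b > 2 * E" using A(2) ab ne unfolding spread_def by blast
        ultimately show False by simp
      qed
      moreover have "finite (C x)" using finA by (simp add: C_def)
      ultimately show ?thesis by (simp add: card_le_Suc0_iff_eq)
    qed
    then have "(\<Sum>x\<in>dom q. card (C x)) \<le> (\<Sum>x\<in>dom q. 1)" by (rule sum_mono)
    then have "card (\<Union>x\<in>dom q. C x) \<le> (\<Sum>x\<in>dom q. 1)" using card_UN_le[OF q(1), of C] by linarith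
    then have "card (\<Union>x\<in>dom q. C x) \<le> 2" using q(3) by simp
    moreover have "A - (\<Union>x\<in>dom q. C x) = {p \<in> A. avail q s p}"
      unfolding C_def avail_def by (simp only: not_le[symmetric]) blast
    moreover have "card (A - (\<Union>x\<in>dom q. C x)) \<ge> card A - card (\<Union>x\<in>dom q. C x)"
      by (rule diff_card_le_card_Diff) (use q finA in \<open>auto simp: C_def\<close>)
    ultimately show "n \<le> 2 * card {p \<in> A. avail q s p}" using n A(3) by simp
  qed
  have inv: "P' (translate q t)" if q: "P' q" and t: "t \<in> carrier G" for q t
    unfolding P'_def
  proof (intro conjI ballI)
    show "P (translate q t)" using q t patch_translate[OF sys] by (simp add: P'_def)
    fix s assume s: "s \<in> carrier G"
    define s' where "s' = s \<otimes> inv t"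
    have s': "s' \<in> carrier G" "s' \<otimes> t = s" using s t by (auto simp: s'_def m_assoc)
    have eq: "a \<otimes> s = (a \<otimes> s') \<otimes> t" if "a \<in> carrier G" for a using that s' t by (metis m_assoc)
    have "sat q s' \<Longrightarrow> sat (translate q t) s"
    proof -
      assume "sat q s'"
      then obtain p where p: "p \<in> A" "translate p0 (fst p \<otimes> s') \<subseteq>\<^sub>m q" "translate p1 (snd p \<otimes> s') \<subseteq>\<^sub>m q"
        by (auto simp: sat_def)
      have "translate p0 (fst p \<otimes> s) \<subseteq>\<^sub>m translate q t" "translate p1 (snd p \<otimes> s) \<subseteq>\<^sub>m translate q t"
        using translate_mono[OF p(2), of t] translate_mono[OF p(3), of t] AG[OF p(1)] s' t
        by (simp_all add: translate_translate eq)
      then show ?thesis using p(1) by (auto simp: sat_def)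
    qed
    moreover have "avail (translate q t) s p" if p: "p \<in> A" "avail q s' p" for p
      unfolding avail_def
    proof (intro ballI)
      fix x assume "x \<in> dom (translate q t)"
      then have x: "x \<in> carrier G" "x \<otimes> inv t \<in> dom q" by (auto simp: dom_translate)
      have xe: "x = (x \<otimes> inv t) \<otimes> t" using x t by (simp add: m_assoc)
      have "gdist (a \<otimes> s) x = gdist (a \<otimes> s') (x \<otimes> inv t)" if "a \<in> carrier G" for a
      proof -
        have "gdist (a \<otimes> s) x = gdist ((a \<otimes> s') \<otimes> t) ((x \<otimes> inv t) \<otimes> t)" using eq[OF that] xe by simp
        also have "\<dots> = gdist (a \<otimes> s') (x \<otimes> inv t)" using that s' t x by (intro gdist_translate) auto
        finally show ?thesis .
      qed
      then show "N < gdist (fst p \<otimes> s) x \<and> N < gdist (snd p \<otimes> s) x"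
        using p(2) x AG[OF p(1)] by (simp add: avail_def)
    qed
    moreover have "sat q s' \<or> n \<le> 2 * card {p \<in> A. avail q s' p}" using q s' by (auto simp: P'_def)
    ultimately show "sat (translate q t) s \<or> n \<le> 2 * card {p \<in> A. avail (translate q t) s p}"
      using subA[of "avail q s'" "avail (translate q t) s"] by (meson le_trans mult_le_mono2)
  qed
  \<comment> \<open>\<open>R'\<close> exceeds the diameter of \<open>A\<close>, so a translate of \<open>A\<close> is near at most one of the two patches.\<close>
  have glue: "P' (q ++ q')" if q: "P' q" and q': "P' q'" and far: "\<And>x y. x \<in> dom q \<Longrightarrow> y \<in> dom q' \<Longrightarrow> gdist x y > R'" for q q'
    unfolding P'_def
  proof (intro conjI ballI)
    have Pq: "P q" "P q'" using q q' by (auto simp: P'_def)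
    show "P (q ++ q')"
    proof (rule patch_glue[OF sys Pq])
      fix x y assume "x \<in> dom q" "y \<in> dom q'"
      then have "R' < gdist x y" by (rule far)
      then show "R < gdist x y" by (simp add: R'_def)
    qed
    have G: "dom q \<subseteq> carrier G" "dom q' \<subseteq> carrier G" using Pq patch_carrier[OF sys] by auto
    have le: "q \<subseteq>\<^sub>m q ++ q'" "q' \<subseteq>\<^sub>m q ++ q'" using patch_glue_disjoint[OF far G(1)] by auto
    fix s assume s: "s \<in> carrier G"
    show "sat (q ++ q') s \<or> n \<le> 2 * card {p \<in> A. avail (q ++ q') s p}"
    proof (cases "\<forall>p\<in>A. avail q s p")
      case True
      then have "card {p \<in> A. avail q' s p} \<le> card {p \<in> A. avail (q ++ q') s p}"
        by (intro subA) (auto simp only: avail_def dom_map_add)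
      then show ?thesis using q' s sat_mono[OF _ le(2)] unfolding P'_def by (meson le_trans mult_le_mono2)
    next
      case False
      then obtain p a x where p: "p \<in> A" "a \<in> {fst p, snd p}" "x \<in> dom q" "gdist (a \<otimes> s) x \<le> N"
        unfolding avail_def by (simp only: not_le[symmetric]) blast
      have xG: "x \<in> carrier G" using p G by auto
      have "avail q' s p'" if p': "p' \<in> A" for p'
        unfolding avail_def
      proof
        fix y assume y: "y \<in> dom q'"
        have "gdist (b \<otimes> s) y > N" if b: "b \<in> {fst p', snd p'}" for b
        proof -
          have bG: "b \<in> carrier G" "y \<in> carrier G" using b p' AG[of p'] y G by auto
          have "gdist x y \<le> gdist x (b \<otimes> s) + gdist (b \<otimes> s) y" using xG bG s by (intro gdist_triangle) auto
          moreover have "gdist x (b \<otimes> s) \<le> N + \<Delta>" using near_all[OF p(1) p' p(2) b s xG p(4) refl] .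
          moreover have "gdist x y > R'" using far p y by blast
          ultimately show ?thesis by (simp add: R'_def)
        qed
        then show "N < gdist (fst p' \<otimes> s) y \<and> N < gdist (snd p' \<otimes> s) y" by blast
      qed
      then have "card {p \<in> A. avail q s p} \<le> card {p \<in> A. avail (q ++ q') s p}"
        by (intro subA) (auto simp only: avail_def dom_map_add)
      then show ?thesis using q s sat_mono[OF _ le(1)] unfolding P'_def by (meson le_trans mult_le_mono2)
    qed
  qed
  have extend: "\<exists>q'. P' q' \<and> q \<subseteq>\<^sub>m q' \<and> V \<subseteq> dom q' \<and> dom q' \<subseteq> nbhd R' V"
    if q: "P' q" and V: "finite V" "V \<subseteq> carrier G" "nbhd R' (dom q) \<subseteq> V" for q V
  proof -
    have Pq: "P q" using q by (simp add: P'_def)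
    have qG: "dom q \<subseteq> carrier G" using patch_carrier[OF sys Pq] .
    define \<Omega> where "\<Omega> = {x \<in> nbhd (N + R + \<Delta>) V. \<forall>y\<in>dom q. gdist x y > N}"
    have \<Omega>: "finite \<Omega>" "\<Omega> \<subseteq> carrier G" using finite_nbhd[OF V(1,2)] nbhd_subset_carrier by (auto simp: \<Omega>_def)
    obtain S0 S1 where S: "S0 \<subseteq> \<Omega>" "S1 \<subseteq> \<Omega>" "S0 \<inter> S1 = {}"
      and sep: "\<forall>x\<in>S0 \<union> S1. \<forall>y\<in>S0 \<union> S1. x \<noteq> y \<longrightarrow> gdist x y > E"
      and hit: "\<forall>s\<in>carrier G. n \<le> 2 * card {p \<in> A. fst p \<otimes> s \<in> \<Omega> \<and> snd p \<otimes> s \<in> \<Omega>} \<longrightarrow>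
         (\<exists>p\<in>A. fst p \<otimes> s \<in> S0 \<and> snd p \<otimes> s \<in> S1)"
      and sparse: "\<forall>s\<in>carrier G. 2 * card {p \<in> A. \<exists>x\<in>S0 \<union> S1. gdist (fst p \<otimes> s) x \<le> E \<or> gdist (snd p \<otimes> s) x \<le> E} \<le> n"
      using sites_n[unfolded has_sites_def, rule_format, OF A(2,3) \<Omega>] by (elim exE conjE) (rule that)
    define S where "S = S0 \<union> S1"
    have SO: "S \<subseteq> \<Omega>" using S by (simp add: S_def)
    have finS: "finite S" and SG: "S \<subseteq> carrier G" using SO \<Omega> finite_subset by blast+
    define l where "l s = (if s \<in> S0 then p0 else p1)" for s
    have "\<exists>q'. P q' \<and> q \<subseteq>\<^sub>m q' \<and> (\<forall>s\<in>S. translate (l s) s \<subseteq>\<^sub>m q') \<and> dom q' \<subseteq> dom q \<union> nbhd \<rho> S"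
    proof (rule patch_glue_sites[OF sys finS SG Pq])
      show "P (l s)" for s using p0 p1 by (simp add: l_def)
      show "len x \<le> \<rho>" if "x \<in> dom (l s)" for s x using that \<rho> by (simp add: l_def split: if_splits)
      show "R + 2 * \<rho> < gdist s s'" if "s \<in> S" "s' \<in> S" "s \<noteq> s'" for s s'
      proof -
        have "E < gdist s s'" using sep that by (simp add: S_def)
        then show ?thesis by (simp add: E_def)
      qed
      show "R + \<rho> < gdist s x" if "s \<in> S" "x \<in> dom q" for s x
        using that SO by (auto simp: \<Omega>_def N_def)
    qed
    then obtain q1 where q1: "P q1" "q \<subseteq>\<^sub>m q1" "\<And>s. s \<in> S \<Longrightarrow> translate (l s) s \<subseteq>\<^sub>m q1"
      "dom q1 \<subseteq> dom q \<union> nbhd \<rho> S" by blast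
    define V1 where "V1 = V \<union> nbhd (R + \<rho>) S"
    have V1: "finite V1" "V1 \<subseteq> carrier G"
      using V finite_nbhd[OF finS SG] nbhd_subset_carrier by (auto simp: V1_def)
    have "nbhd R (dom q1) \<subseteq> V1"
    proof
      fix x assume "x \<in> nbhd R (dom q1)"
      then obtain y where xy: "x \<in> carrier G" "y \<in> dom q1" "gdist x y \<le> R" by (auto simp: nbhd_def)
      consider "y \<in> dom q" | "y \<in> nbhd \<rho> S" using q1(4) xy by blast
      then show "x \<in> V1"
      proof cases
        case 1
        have "gdist x y \<le> R'" using xy by (simp add: R'_def)
        then have "x \<in> nbhd R' (dom q)" using 1 xy unfolding nbhd_def by blast
        then show ?thesis using V(3) by (auto simp: V1_def)
      next
        case 2
        then obtain s where s: "y \<in> carrier G" "s \<in> S" "gdist y s \<le> \<rho>" by (auto simp: nbhd_def)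
        have "gdist x s \<le> gdist x y + gdist y s" using xy s SG by (intro gdist_triangle) auto
        then have "gdist x s \<le> R + \<rho>" using xy s by linarith
        then show ?thesis using xy s by (auto simp: V1_def nbhd_def)
      qed
    qed
    then obtain q2 where q2: "P q2" "q1 \<subseteq>\<^sub>m q2" "V1 \<subseteq> dom q2" "dom q2 \<subseteq> nbhd R V1"
      using patch_extend[OF sys q1(1) V1] by blast
    have dom2: "(\<exists>v\<in>V. gdist x v \<le> R) \<or> (\<exists>s\<in>S. gdist x s \<le> 2 * R + \<rho>)" "x \<in> carrier G" if x: "x \<in> dom q2" for x
    proof -
      obtain y where y: "x \<in> carrier G" "y \<in> V1" "gdist x y \<le> R" using q2(4) x by (auto simp: nbhd_def)
      then show "x \<in> carrier G" by simp
      consider "y \<in> V" | "y \<in> nbhd (R + \<rho>) S" using y by (auto simp: V1_def)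
      then show "(\<exists>v\<in>V. gdist x v \<le> R) \<or> (\<exists>s\<in>S. gdist x s \<le> 2 * R + \<rho>)"
      proof cases
        case 1
        then show ?thesis using y by blast
      next
        case 2
        then obtain s where s: "y \<in> carrier G" "s \<in> S" "gdist y s \<le> R + \<rho>" by (auto simp: nbhd_def)
        have "gdist x s \<le> gdist x y + gdist y s" using y s SG by (intro gdist_triangle) auto
        then have "gdist x s \<le> 2 * R + \<rho>" using y s by linarith
        then show ?thesis using s by blast
      qed
    qed
    have "dom q2 \<subseteq> nbhd R' V"
    proof
      fix x assume x: "x \<in> dom q2"
      have xG: "x \<in> carrier G" using dom2[OF x] by simp
      from dom2(1)[OF x] show "x \<in> nbhd R' V"
      proof
        assume "\<exists>v\<in>V. gdist x v \<le> R"
        then obtain v where "v \<in> V" "gdist x v \<le> R" by blast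
        then show ?thesis using xG by (force simp: nbhd_def R'_def)
      next
        assume "\<exists>s\<in>S. gdist x s \<le> 2 * R + \<rho>"
        then obtain s where s: "s \<in> S" "gdist x s \<le> 2 * R + \<rho>" by blast
        then obtain v where v: "v \<in> V" "gdist s v \<le> N + R + \<Delta>" using SO by (auto simp: \<Omega>_def nbhd_def)
        have "gdist x v \<le> gdist x s + gdist s v" using xG s v V SG by (intro gdist_triangle) auto
        then have "gdist x v \<le> R'" using s v by (simp add: R'_def)
        then show ?thesis using xG v by (auto simp: nbhd_def)
      qed
    qed
    moreover have qq2: "q \<subseteq>\<^sub>m q2" using q1(2) q2(2) by (rule map_le_trans)
    moreover have "V \<subseteq> dom q2" using q2(3) by (auto simp: V1_def)
    moreover have "P' q2"
      unfolding P'_def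
    proof (intro conjI ballI)
      show "P q2" by fact
      fix s assume s: "s \<in> carrier G"
      show "sat q2 s \<or> n \<le> 2 * card {p \<in> A. avail q2 s p}"
      proof (cases "sat q s")
        case True
        then show ?thesis using sat_mono[OF _ qq2] by blast
      next
        case False
        then have av: "n \<le> 2 * card {p \<in> A. avail q s p}" using q s by (auto simp: P'_def)
        show ?thesis
        proof (cases "\<exists>p\<in>A. \<exists>a\<in>{fst p, snd p}. \<exists>v\<in>V. gdist (a \<otimes> s) v \<le> N + R")
          case True
          then obtain p a v where p: "p \<in> A" "a \<in> {fst p, snd p}" "v \<in> V" "gdist (a \<otimes> s) v \<le> N + R" by blast
          have "b \<otimes> s \<in> nbhd (N + R + \<Delta>) V" if b: "p' \<in> A" "b \<in> {fst p', snd p'}" for p' b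
          proof -
            have G: "a \<in> carrier G" "b \<in> carrier G" "v \<in> carrier G" using b AG[of p'] p AG[of p] V by auto
            have "gdist (b \<otimes> s) v \<le> gdist (b \<otimes> s) (a \<otimes> s) + gdist (a \<otimes> s) v" using G s by (intro gdist_triangle) auto
            then have "gdist (b \<otimes> s) v \<le> N + R + \<Delta>" using \<Delta>[OF b(1) p(1) b(2) p(2) s] p by linarith
            then show ?thesis using p G s by (auto simp: nbhd_def)
          qed
          then have "card {p \<in> A. avail q s p} \<le> card {p \<in> A. fst p \<otimes> s \<in> \<Omega> \<and> snd p \<otimes> s \<in> \<Omega>}"
            by (intro subA) (simp add: \<Omega>_def avail_def)
          then have "n \<le> 2 * card {p \<in> A. fst p \<otimes> s \<in> \<Omega> \<and> snd p \<otimes> s \<in> \<Omega>}" using av by linarith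
          then obtain p' where p': "p' \<in> A" "fst p' \<otimes> s \<in> S0" "snd p' \<otimes> s \<in> S1" using hit s by blast
          have "l (fst p' \<otimes> s) = p0" "l (snd p' \<otimes> s) = p1" using p' S by (auto simp: l_def)
          then have "translate p0 (fst p' \<otimes> s) \<subseteq>\<^sub>m q1" "translate p1 (snd p' \<otimes> s) \<subseteq>\<^sub>m q1"
            using q1(3)[of "fst p' \<otimes> s"] q1(3)[of "snd p' \<otimes> s"] p' by (auto simp: S_def)
          then show ?thesis using p'(1) q2(2) map_le_trans unfolding sat_def by blast
        next
          case False
          define B where "B = {p \<in> A. \<exists>x\<in>S0 \<union> S1. gdist (fst p \<otimes> s) x \<le> E \<or> gdist (snd p \<otimes> s) x \<le> E}"
          have "avail q2 s p" if p: "p \<in> A - B" for p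
            unfolding avail_def
          proof
            fix x assume x: "x \<in> dom q2"
            have "gdist (a \<otimes> s) x > N" if a: "a \<in> {fst p, snd p}" for a
            proof (rule ccontr)
              assume "\<not> gdist (a \<otimes> s) x > N"
              then have ax: "gdist (a \<otimes> s) x \<le> N" by simp
              have aG: "a \<in> carrier G" using a p AG[of p] by auto
              have xG: "x \<in> carrier G" using dom2[OF x] by simp
              have tri: "gdist (a \<otimes> s) z \<le> N + gdist x z" if "z \<in> carrier G" for z
                using gdist_triangle[of "a \<otimes> s" x z] aG xG s that ax by simp
              from dom2(1)[OF x] show False
              proof
                assume "\<exists>v\<in>V. gdist x v \<le> R"
                then obtain v where v: "v \<in> V" "gdist x v \<le> R" by blast
                then have "gdist (a \<otimes> s) v \<le> N + R" using tri[of v] V by auto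
                then show False using False p a v by blast
              next
                assume "\<exists>z\<in>S. gdist x z \<le> 2 * R + \<rho>"
                then obtain z where z: "z \<in> S" "gdist x z \<le> 2 * R + \<rho>" by blast
                then have "gdist (a \<otimes> s) z \<le> E" using tri[of z] SG by (auto simp: E_def N_def)
                then have "p \<in> B" using p a z by (auto simp: B_def S_def)
                then show False using p by simp
              qed
            qed
            then show "N < gdist (fst p \<otimes> s) x \<and> N < gdist (snd p \<otimes> s) x" by blast
          qed
          then have "card (A - B) \<le> card {p \<in> A. avail q2 s p}" using finA by (intro card_mono) auto
          moreover have "card (A - B) = n - card B" using A(3) finA by (subst card_Diff_subset) (auto simp: B_def)
          moreover have "2 * card B \<le> n" using sparse s by (simp add: B_def)
          ultimately show ?thesis by linarith
        qed
      qed
    qed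
    ultimately show ?thesis by blast
  qed
  have "patch_system P' R'"
    unfolding patch_system_def
  proof (intro conjI allI impI)
    fix q assume "P' q"
    then have "P q" by (simp add: P'_def)
    then show "finite (dom q)" "dom q \<subseteq> carrier G" using patch_finite[OF sys] patch_carrier[OF sys] by blast+
  next
    fix q q' assume "P' q" "P' q'" "\<forall>x\<in>dom q. \<forall>y\<in>dom q'. R' < gdist x y"
    then show "P' (q ++ q')" using glue[of q q'] by blast
  next
    fix q :: "'g \<rightharpoonup> bool" assume "finite (dom q)" "dom q \<subseteq> carrier G" "card (dom q) \<le> 2"
    then show "P' q" by (rule small)
  next
    fix q s assume "P' q" "s \<in> carrier G"
    then show "P' (translate q s)" by (rule inv)
  next
    fix q V assume "P' q" "finite V" "V \<subseteq> carrier G" "nbhd R' (dom q) \<subseteq> V"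
    then show "\<exists>q'. P' q' \<and> q \<subseteq>\<^sub>m q' \<and> V \<subseteq> dom q' \<and> dom q' \<subseteq> nbhd R' V"
      by (rule extend)
  qed
  moreover have "finite W"
    unfolding W_def using finA AG patch_finite[OF sys p0] patch_finite[OF sys p1]
    by (intro finite_UN_I finite_UnI finite_dom_translate) auto
  moreover have "W \<subseteq> carrier G" using AG by (auto simp: W_def dom_translate)
  moreover have "\<exists>p\<in>I. translate p0 (fst p) \<subseteq>\<^sub>m q |` W \<and> translate p1 (snd p) \<subseteq>\<^sub>m q |` W"
    if q: "P' q" "W \<subseteq> dom q" for q
  proof -
    \<comment> \<open>Since \<open>W\<close> contains \<open>A\<close>, no pair of the untranslated list is available.\<close>
    have "\<not> avail q \<one> p" if p: "p \<in> A" for p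
    proof
      assume "avail q \<one> p"
      moreover have "fst p \<in> dom q" using p q by (auto simp: W_def)
      ultimately have "gdist (fst p \<otimes> \<one>) (fst p) > N" by (auto simp: avail_def)
      then show False using AG[OF p] by simp
    qed
    then have "{p \<in> A. avail q \<one> p} = {}" by blast
    then have "card {p \<in> A. avail q \<one> p} = 0" by (simp only: card.empty)
    moreover have "sat q \<one> \<or> n \<le> 2 * card {p \<in> A. avail q \<one> p}"
      using q(1) one_closed unfolding P'_def by blast
    ultimately have "sat q \<one>" using n by linarith
    then obtain p where p: "p \<in> A" "translate p0 (fst p) \<subseteq>\<^sub>m q" "translate p1 (snd p) \<subseteq>\<^sub>m q"
      using AG by (auto simp: sat_def)
    have "dom (translate p0 (fst p)) \<subseteq> W" "dom (translate p1 (snd p)) \<subseteq> W" using p(1) by (auto simp: W_def)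
    then have "translate p0 (fst p) \<subseteq>\<^sub>m q |` W" "translate p1 (snd p) \<subseteq>\<^sub>m q |` W"
      using p(2,3) by (auto simp: map_le_def)
    then show ?thesis using p(1) A(1) by blast
  qed
  moreover have "\<forall>q. P' q \<longrightarrow> P q" by (simp add: P'_def)
  ultimately show ?thesis by blast
qed

end

section \<open>Subshifts from patch systems\<close>

lemma topspace_shift_space: "topspace (shift_space G) = carrier G \<rightarrow>\<^sub>E UNIV"
  by (simp add: shift_space_def)

lemma compact_space_shift_space: "compact_space (shift_space G)"
  by (simp add: shift_space_def compact_space_product_topology compact_space_discrete_topology)

lemma Hausdorff_space_shift_space: "Hausdorff_space (shift_space G)"
  by (simp add: shift_space_def Hausdorff_space_product_topology)

lemma openin_cylinder:
  assumes "finite W"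
  shows "openin (shift_space G) {y \<in> topspace (shift_space G). \<forall>x\<in>W \<inter> carrier G. y x = z x}"
proof -
  let ?X = "\<lambda>x. if x \<in> W \<inter> carrier G then {z x} else UNIV"
  have "finite {x. ?X x \<noteq> topspace (discrete_topology UNIV)}"
    by (rule finite_subset[OF _ assms]) auto
  then have "openin (product_topology (\<lambda>_. discrete_topology UNIV) (carrier G)) (\<Pi>\<^sub>E x\<in>carrier G. ?X x)"
    by (intro product_topology_basis) auto
  moreover have "(\<Pi>\<^sub>E x\<in>carrier G. ?X x) = {y \<in> topspace (shift_space G). \<forall>x\<in>W \<inter> carrier G. y x = z x}"
    by (auto simp: topspace_shift_space PiE_iff extensional_def split: if_splits)
  ultimately show ?thesis by (simp add: shift_space_def)
qed

lemma openin_shift_space_cylinder: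
  assumes "openin (shift_space G) U" "y \<in> U"
  shows "\<exists>W. finite W \<and> W \<subseteq> carrier G \<and>
    {z \<in> topspace (shift_space G). \<forall>x\<in>W. z x = y x} \<subseteq> U"
proof -
  obtain X where X: "y \<in> (\<Pi>\<^sub>E i\<in>carrier G. X i)" "finite {i. X i \<noteq> topspace (discrete_topology (UNIV::bool set))}"
    "(\<Pi>\<^sub>E i\<in>carrier G. X i) \<subseteq> U"
    using product_topology_open_contains_basis[OF assms[unfolded shift_space_def]] by blast
  let ?W = "{i. X i \<noteq> topspace (discrete_topology (UNIV::bool set))} \<inter> carrier G"
  have "{z \<in> topspace (shift_space G). \<forall>x\<in>?W. z x = y x} \<subseteq> (\<Pi>\<^sub>E i\<in>carrier G. X i)"
  proof
    fix z assume z: "z \<in> {z \<in> topspace (shift_space G). \<forall>x\<in>?W. z x = y x}"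
    have "z i \<in> X i" if "i \<in> carrier G" for i
      using z X(1) that by (cases "i \<in> ?W") (auto simp: PiE_iff)
    then show "z \<in> (\<Pi>\<^sub>E i\<in>carrier G. X i)" using z by (auto simp: topspace_shift_space PiE_iff)
  qed
  then show ?thesis using X(2,3) by (intro exI[of _ ?W]) auto
qed

lemma closedin_finitely_determined:
  assumes "finite W" "\<And>y z. (\<And>x. x \<in> W \<inter> carrier G \<Longrightarrow> y x = z x) \<Longrightarrow> \<Phi> y \<Longrightarrow> \<Phi> z"
  shows "closedin (shift_space G) {y \<in> topspace (shift_space G). \<Phi> y}"
  unfolding closedin_def
proof (intro conjI)
  let ?C = "topspace (shift_space G) - {y \<in> topspace (shift_space G). \<Phi> y}"
  show "openin (shift_space G) ?C"
  proof (subst openin_subopen, intro ballI)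
    fix z assume z: "z \<in> ?C"
    let ?N = "{y \<in> topspace (shift_space G). \<forall>x\<in>W \<inter> carrier G. y x = z x}"
    have "?N \<subseteq> ?C" using z assms(2)[of _ z] by auto
    then show "\<exists>T. openin (shift_space G) T \<and> z \<in> T \<and> T \<subseteq> ?C"
      using z openin_cylinder[OF assms(1), of G z] by (intro exI[of _ ?N]) auto
  qed
qed auto

definition realises :: "('g \<Rightarrow> bool) \<Rightarrow> ('g \<rightharpoonup> bool) \<Rightarrow> bool" where
  "realises y q \<longleftrightarrow> (\<forall>x\<in>dom q. q x = Some (y x))"

lemma realises_mono: "realises y q \<Longrightarrow> p \<subseteq>\<^sub>m q \<Longrightarrow> realises y p"
  by (auto simp: realises_def map_le_def dom_def)

context length_group begin

lemma realises_shift: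
  assumes "y \<in> topspace (shift_space G)" "g \<in> carrier G" "dom q \<subseteq> carrier G" "realises y (translate q g)"
  shows "realises (shift_action G g y) q"
  unfolding realises_def
proof
  fix x assume x: "x \<in> dom q"
  then have xG: "x \<in> carrier G" using assms by auto
  then have "translate q g (x \<otimes> g) = q x" using assms by (simp add: translate_def m_assoc)
  moreover have "x \<otimes> g \<in> dom (translate q g)" using x xG assms by (simp add: dom_translate m_assoc)
  ultimately have "q x = Some (y (x \<otimes> g))" using assms(4) by (metis realises_def)
  then show "q x = Some (shift_action G g y x)" using assms xG by (simp add: shift_action_def)
qed

lemma shift_in_topspace:
  "y \<in> topspace (shift_space G) \<Longrightarrow> shift_action G g y \<in> topspace (shift_space G)"
  by (simp add: shift_action_def topspace_shift_space)

text \<open>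
  A task \<open>(I, p0, p1)\<close> asks that every point of \<open>Y\<close> contains \<open>p0\<close> and \<open>p1\<close> at the two positions of some pair in
  \<open>I\<close>, provided that both patterns occur in \<open>Y\<close>. The tasks are treated in turn, along a decreasing sequence of
  patch systems: the current system is thinned out for the task if both patterns still extend to patches
  of the system, and otherwise at least one of them can no longer occur. \<open>Y\<close> consists of the points all of whose
  finite windows extend to patches of every system; a patch that belongs to all systems occurs in \<open>Y\<close> by
  compactness.
\<close>

theorem exists_subshift:
  fixes tasks :: "(('g \<times> 'g) set \<times> ('g \<rightharpoonup> bool) \<times> ('g \<rightharpoonup> bool)) set"
  assumes "countable tasks" "tasks \<noteq> {}"
    and tasks: "\<forall>(I, p0, p1)\<in>tasks. escaping I \<and> finite (dom p0) \<and> dom p0 \<subseteq> carrier G \<and>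
      finite (dom p1) \<and> dom p1 \<subseteq> carrier G"
  shows "\<exists>Y. closedin (shift_space G) Y \<and> (\<forall>y\<in>Y. \<forall>g\<in>carrier G. shift_action G g y \<in> Y) \<and>
    (\<forall>q. finite (dom q) \<longrightarrow> dom q \<subseteq> carrier G \<longrightarrow> card (dom q) \<le> 2 \<longrightarrow> (\<exists>y\<in>Y. realises y q)) \<and>
    (\<forall>(I, p0, p1)\<in>tasks. (\<exists>y\<in>Y. realises y p0) \<longrightarrow> (\<exists>y\<in>Y. realises y p1) \<longrightarrow>
      (\<forall>y\<in>Y. \<exists>p\<in>I. realises (shift_action G (fst p) y) p0 \<and> realises (shift_action G (snd p) y) p1))"
proof -
  have task: "escaping I \<and> finite (dom p0) \<and> dom p0 \<subseteq> carrier G \<and> finite (dom p1) \<and> dom p1 \<subseteq> carrier G"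
    if "(I, p0, p1) \<in> tasks" for I p0 p1
    using bspec[OF tasks that] by simp
  define forces where "forces P t \<longleftrightarrow> (\<exists>W. finite W \<and> W \<subseteq> carrier G \<and> (\<forall>q. P q \<longrightarrow> W \<subseteq> dom q \<longrightarrow>
      (\<exists>p\<in>fst t. translate (fst (snd t)) (fst p) \<subseteq>\<^sub>m q |` W \<and> translate (snd (snd t)) (snd p) \<subseteq>\<^sub>m q |` W)))"
    for P :: "('g \<rightharpoonup> bool) \<Rightarrow> bool" and t
  define step where "step t A B \<longleftrightarrow> (\<forall>q. fst B q \<longrightarrow> fst A q) \<and>
     ((\<exists>q. fst A q \<and> fst (snd t) \<subseteq>\<^sub>m q) \<longrightarrow> (\<exists>q. fst A q \<and> snd (snd t) \<subseteq>\<^sub>m q) \<longrightarrow> forces (fst B) t)"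
    for t and A B :: "(('g \<rightharpoonup> bool) \<Rightarrow> bool) \<times> nat"
  define t where "t n = from_nat_into tasks n" for n
  have t: "t n \<in> tasks" for n using assms(2) by (simp add: t_def from_nat_into)
  have "\<exists>f. \<forall>n. patch_system (fst (f n)) (snd (f n)) \<and> step (t n) (f n) (f (Suc n))"
  proof (rule dependent_nat_choice)
    show "\<exists>A. patch_system (fst A) (snd A)" using patch_system_full by (metis fst_conv snd_conv)
  next
    fix A :: "(('g \<rightharpoonup> bool) \<Rightarrow> bool) \<times> nat" and n
    assume A: "patch_system (fst A) (snd A)"
    obtain I p0 p1 where tn: "t n = (I, p0, p1)" by (cases "t n")
    have esc: "escaping I" using task t[of n] tn by auto
    show "\<exists>B. patch_system (fst B) (snd B) \<and> step (t n) A B"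
    proof (cases "(\<exists>q. fst A q \<and> p0 \<subseteq>\<^sub>m q) \<and> (\<exists>q. fst A q \<and> p1 \<subseteq>\<^sub>m q)")
      case True
      then obtain q0 q1 where q: "fst A q0" "p0 \<subseteq>\<^sub>m q0" "fst A q1" "p1 \<subseteq>\<^sub>m q1" by blast
      obtain P' R' W where P': "patch_system P' R'" "\<forall>q. P' q \<longrightarrow> fst A q" "finite W" "W \<subseteq> carrier G"
        and W: "\<forall>q. P' q \<longrightarrow> W \<subseteq> dom q \<longrightarrow>
          (\<exists>p\<in>I. translate q0 (fst p) \<subseteq>\<^sub>m q |` W \<and> translate q1 (snd p) \<subseteq>\<^sub>m q |` W)"
        using patch_system_step[OF A q(1,3) esc] by (elim exE conjE) (rule that)
      have "forces P' (t n)"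
        unfolding forces_def tn fst_conv snd_conv
      proof (intro exI[of _ W] conjI allI impI)
        fix q assume "P' q" "W \<subseteq> dom q"
        then obtain p where p: "p \<in> I" "translate q0 (fst p) \<subseteq>\<^sub>m q |` W" "translate q1 (snd p) \<subseteq>\<^sub>m q |` W"
          using W by blast
        then show "\<exists>p\<in>I. translate p0 (fst p) \<subseteq>\<^sub>m q |` W \<and> translate p1 (snd p) \<subseteq>\<^sub>m q |` W"
          using translate_mono[OF q(2)] translate_mono[OF q(4)] map_le_trans by blast
      qed (use P' in auto)
      then show ?thesis using P' by (intro exI[of _ "(P', R')"]) (simp add: step_def)
    next
      case False
      then show ?thesis using A by (intro exI[of _ A]) (auto simp: step_def tn)
    qed
  qed
  then obtain f where f: "\<And>n. patch_system (fst (f n)) (snd (f n))" "\<And>n. step (t n) (f n) (f (Suc n))" by blast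
  define Q where "Q n = fst (f n)" for n
  have sys: "patch_system (Q n) (snd (f n))" for n using f(1) by (simp add: Q_def)
  have antimono: "Q m q" if "Q n q" "m \<le> n" for m n q
    using that(2,1) by (induction rule: dec_induct) (use f(2) in \<open>auto simp: Q_def step_def\<close>)
  have forced: "forces (Q (Suc n)) (t n)"
    if "\<exists>q. Q n q \<and> fst (snd (t n)) \<subseteq>\<^sub>m q" "\<exists>q. Q n q \<and> snd (snd (t n)) \<subseteq>\<^sub>m q" for n
    using that f(2)[of n] by (simp add: Q_def step_def)
  define good where "good n W y \<longleftrightarrow> (\<exists>q. Q n q \<and> W \<subseteq> dom q \<and> (\<forall>x\<in>W. q x = Some (y x)))" for n W and y :: "'g \<Rightarrow> bool"
  define Y where "Y = {y \<in> topspace (shift_space G). \<forall>n W. finite W \<longrightarrow> W \<subseteq> carrier G \<longrightarrow> good n W y}"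
  have good_cong: "good n W z" if "\<And>x. x \<in> W \<inter> carrier G \<Longrightarrow> y x = z x" "good n W y" "W \<subseteq> carrier G" for n W y z
  proof -
    have "y x = z x" if "x \<in> W" for x using that \<open>W \<subseteq> carrier G\<close> \<open>\<And>x. x \<in> W \<inter> carrier G \<Longrightarrow> y x = z x\<close> by blast
    then show ?thesis using that(2) by (auto simp: good_def)
  qed
  have closed_good: "closedin (shift_space G) {y \<in> topspace (shift_space G). good n W y}" if "finite W" "W \<subseteq> carrier G" for n W
    using that(1) by (rule closedin_finitely_determined) (use good_cong that in blast)
  have Yeq: "Y = (\<Inter>(n, W)\<in>UNIV \<times> {W. finite W \<and> W \<subseteq> carrier G}. {y \<in> topspace (shift_space G). good n W y})"
    by (auto simp: Y_def)
  have "closedin (shift_space G) Y"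
    unfolding Yeq by (rule closedin_INT) (use closed_good in auto)
  moreover have "shift_action G g y \<in> Y" if y: "y \<in> Y" and g: "g \<in> carrier G" for y g
  proof -
    have yT: "y \<in> topspace (shift_space G)" using y by (simp add: Y_def)
    have "good n W (shift_action G g y)" if W: "finite W" "W \<subseteq> carrier G" for n W
    proof -
      let ?W = "(\<lambda>x. x \<otimes> g) ` W"
      have "finite ?W" "?W \<subseteq> carrier G" using W g by auto
      then have "good n ?W y" using y by (simp add: Y_def)
      then obtain q where q: "Q n q" "?W \<subseteq> dom q" "\<forall>x\<in>?W. q x = Some (y x)" by (auto simp: good_def)
      let ?q = "translate q (inv g)"
      have "?q x = Some (shift_action G g y x)" if "x \<in> W" for x
      proof -
        have "x \<in> carrier G" using that W by auto
        then show ?thesis using q(3) that g yT by (simp add: translate_def shift_action_def)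
      qed
      moreover have "Q n ?q" using patch_translate[OF sys q(1)] g by simp
      ultimately show ?thesis unfolding good_def by (intro exI[of _ ?q]) (auto simp: dom_def)
    qed
    then show ?thesis using shift_in_topspace[OF yT] by (simp add: Y_def)
  qed
  moreover have "\<exists>y\<in>Y. realises y q" if q: "finite (dom q)" "dom q \<subseteq> carrier G" "card (dom q) \<le> 2" for q
  proof -
    have Qq: "Q n q" for n using patch_small[OF sys q] .
    define C where "C = (\<lambda>(n::nat, W). {y \<in> topspace (shift_space G). realises y q \<and> good n W y})"
    define Ix where "Ix = (UNIV :: nat set) \<times> {W. finite W \<and> W \<subseteq> carrier G}"
    \<comment> \<open>Finitely many conditions concern one finite window and, as the systems decrease, one system.\<close>
    have "\<Inter>(C ` Ix) \<noteq> {}"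
    proof (rule compact_space_shift_space[of G, unfolded compact_space_fip, rule_format], intro conjI ballI allI impI)
      fix D assume "D \<in> C ` Ix"
      then obtain n W where D: "D = C (n, W)" "finite W" "W \<subseteq> carrier G" by (auto simp: Ix_def)
      have "closedin (shift_space G) {y \<in> topspace (shift_space G). realises y q \<and> good n W y}"
      proof (rule closedin_finitely_determined[where W = "W \<union> dom q"])
        show "finite (W \<union> dom q)" using D q by simp
        fix y z :: "'g \<Rightarrow> bool" assume yz: "\<And>x. x \<in> (W \<union> dom q) \<inter> carrier G \<Longrightarrow> y x = z x" "realises y q \<and> good n W y"
        have "good n W z" using good_cong[of W y z n] yz D by blast
        moreover have "y x = z x" if "x \<in> dom q" for x using yz(1)[of x] that q(2) by blast
        then have "realises z q" using yz(2) unfolding realises_def by simp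
        ultimately show "realises z q \<and> good n W z" by blast
      qed
      then show "closedin (shift_space G) D" using D by (simp add: C_def)
    next
      fix \<F> assume "finite \<F> \<and> \<F> \<subseteq> C ` Ix"
      then obtain K where K: "K \<subseteq> Ix" "finite K" "\<F> = C ` K" by (meson finite_subset_image)
      define n where "n = Max (insert 0 (fst ` K))"
      define V where "V = nbhd (snd (f n)) (dom q) \<union> dom q \<union> (\<Union>k\<in>K. snd k)"
      have K': "finite (snd k)" "snd k \<subseteq> carrier G" if "k \<in> K" for k
        using subsetD[OF K(1) that] by (auto simp: Ix_def mem_Times_iff)
      have "finite V" using finite_nbhd[OF q(1,2)] q(1) K(2) K'(1) by (simp add: V_def)
      moreover have "V \<subseteq> carrier G" using nbhd_subset_carrier q(2) K'(2) unfolding V_def by blast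
      ultimately have V: "finite V" "V \<subseteq> carrier G" .
      have "nbhd (snd (f n)) (dom q) \<subseteq> V" by (auto simp: V_def)
      then obtain q' where q': "Q n q'" "q \<subseteq>\<^sub>m q'" "V \<subseteq> dom q'"
        using patch_extend[OF sys Qq V] by blast
      define y where "y = (\<lambda>x\<in>carrier G. the (q' x))"
      have y: "y \<in> topspace (shift_space G)" by (simp add: y_def topspace_shift_space)
      have yq': "q' x = Some (y x)" if "x \<in> dom q'" for x
        using that patch_carrier[OF sys q'(1)] by (auto simp: y_def)
      have "realises y q'" using yq' by (simp add: realises_def)
      then have "realises y q" using q'(2) by (rule realises_mono)
      moreover have "good m W y" if "(m, W) \<in> K" for m W
      proof -
        have "m \<in> insert 0 (fst ` K)" using that by (metis fst_conv image_eqI insertI2)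
        then have "m \<le> n" using K(2) unfolding n_def by (intro Max_ge) auto
        then have "Q m q'" using q'(1) antimono by blast
        moreover have "W \<subseteq> V" using that by (auto simp: V_def intro!: bexI[of _ "(m, W)"])
        then have "W \<subseteq> dom q'" using q'(3) by blast
        ultimately show ?thesis using yq' by (auto simp: good_def)
      qed
      ultimately have "y \<in> \<Inter>\<F>" using y K(3) by (auto simp: C_def)
      then show "\<Inter>\<F> \<noteq> {}" by blast
    qed
    then obtain y where y: "y \<in> \<Inter>(C ` Ix)" by blast
    have "y \<in> C (0, {})" using y by (auto simp: Ix_def)
    then have "realises y q" "y \<in> topspace (shift_space G)" by (auto simp: C_def)
    moreover have "good n W y" if "finite W" "W \<subseteq> carrier G" for n W
    proof -
      have "y \<in> C (n, W)" using y that by (auto simp: Ix_def)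
      then show ?thesis by (simp add: C_def)
    qed
    ultimately show ?thesis by (auto simp: Y_def)
  qed
  moreover have "\<exists>p\<in>I. realises (shift_action G (fst p) y) p0 \<and> realises (shift_action G (snd p) y) p1"
    if I: "(I, p0, p1) \<in> tasks" and ex: "\<exists>y\<in>Y. realises y p0" "\<exists>y\<in>Y. realises y p1" and y: "y \<in> Y" for I p0 p1 y
  proof -
    obtain n where n: "t n = (I, p0, p1)" using I assms(1) unfolding t_def by (metis from_nat_into_surj)
    have T: "escaping I" "finite (dom p0)" "dom p0 \<subseteq> carrier G" "finite (dom p1)" "dom p1 \<subseteq> carrier G" using task[OF I] by auto
    have patch: "\<exists>q. Q n q \<and> p \<subseteq>\<^sub>m q" if p: "\<exists>y\<in>Y. realises y p" "finite (dom p)" "dom p \<subseteq> carrier G" for p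
    proof -
      obtain z where z: "z \<in> Y" "realises z p" using p(1) by blast
      then have "good n (dom p) z" using p(2,3) by (simp add: Y_def)
      then obtain q where q: "Q n q" "\<forall>x\<in>dom p. q x = Some (z x)" by (auto simp: good_def)
      then have "p \<subseteq>\<^sub>m q" using z(2) by (simp add: map_le_def realises_def)
      then show ?thesis using q by blast
    qed
    have "forces (Q (Suc n)) (t n)" using forced[of n] patch[OF ex(1) T(2,3)] patch[OF ex(2) T(4,5)] n by simp
    then obtain W where W: "finite W" "W \<subseteq> carrier G" "\<forall>q. Q (Suc n) q \<longrightarrow> W \<subseteq> dom q \<longrightarrow>
      (\<exists>p\<in>I. translate p0 (fst p) \<subseteq>\<^sub>m q |` W \<and> translate p1 (snd p) \<subseteq>\<^sub>m q |` W)"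
      unfolding forces_def n fst_conv snd_conv by blast
    have yT: "y \<in> topspace (shift_space G)" and "good (Suc n) W y" using y W by (auto simp: Y_def)
    then obtain q where q: "Q (Suc n) q" "W \<subseteq> dom q" "\<forall>x\<in>W. q x = Some (y x)" by (auto simp: good_def)
    then obtain p where p: "p \<in> I" "translate p0 (fst p) \<subseteq>\<^sub>m q |` W" "translate p1 (snd p) \<subseteq>\<^sub>m q |` W"
      using W(3) by blast
    have "realises y (q |` W)" using q(3) by (auto simp: realises_def restrict_map_def split: if_splits)
    then have "realises y (translate p0 (fst p))" "realises y (translate p1 (snd p))"
      using p realises_mono by blast+
    moreover have "fst p \<in> carrier G" "snd p \<in> carrier G" using T(1) p(1) by (auto simp: escaping_def)
    ultimately show ?thesis using realises_shift[OF yT _ T(3)] realises_shift[OF yT _ T(5)] p(1) by blast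
  qed
  ultimately show ?thesis
    by (intro exI[of _ Y] conjI ballI allI impI) (blast | clarify, blast)+
qed

end

section \<open>Free subshifts with dense returns\<close>

lemma countable_finite_patches:
  assumes "countable C"
  shows "countable {p :: 'g \<rightharpoonup> bool. finite (dom p) \<and> dom p \<subseteq> C}"
proof -
  define m :: "('g \<times> bool) set \<Rightarrow> 'g \<rightharpoonup> bool"
    where "m S = (\<lambda>x. if (x, True) \<in> S then Some True else if (x, False) \<in> S then Some False else None)" for S
  have "{p :: 'g \<rightharpoonup> bool. finite (dom p) \<and> dom p \<subseteq> C} \<subseteq> m ` {S. finite S \<and> S \<subseteq> C \<times> UNIV}"
  proof
    fix p :: "'g \<rightharpoonup> bool" assume p: "p \<in> {p. finite (dom p) \<and> dom p \<subseteq> C}"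
    define S where "S = (\<lambda>x. (x, the (p x))) ` dom p"
    have "p x = m S x" for x
    proof (cases "p x")
      case (Some b)
      then show ?thesis by (cases b) (auto simp: m_def S_def image_iff dom_def)
    next
      case None
      then show ?thesis by (auto simp: m_def S_def image_iff dom_def)
    qed
    moreover have "finite S" "S \<subseteq> C \<times> UNIV" using p by (auto simp: S_def)
    ultimately show "p \<in> m ` {S. finite S \<and> S \<subseteq> C \<times> UNIV}" by (intro image_eqI[of _ _ S]) auto
  qed
  moreover have "countable {S. finite S \<and> S \<subseteq> C \<times> (UNIV :: bool set)}"
    using assms by (intro countable_Collect_finite_subset) auto
  ultimately show ?thesis by (rule countable_subset[OF _ countable_image])
qed

context length_group begin

text \<open>
  The elements that conjugate \<open>g\<close> to \<open>v\<close> form a coset of the centralizer of \<open>g\<close>, if there are any.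
\<close>

lemma finite_conjugators:
  assumes g: "g \<in> carrier G" and v: "v \<in> carrier G"
    and fin: "finite {d \<in> carrier G. d \<otimes> g = g \<otimes> d}"
  shows "finite {d \<in> carrier G. d \<otimes> g \<otimes> inv d = v}"
proof (cases "\<exists>e\<in>carrier G. e \<otimes> g \<otimes> inv e = v")
  case True
  then obtain e where e: "e \<in> carrier G" "e \<otimes> g \<otimes> inv e = v" by blast
  have "{d \<in> carrier G. d \<otimes> g \<otimes> inv d = v} \<subseteq> (\<lambda>c. e \<otimes> c) ` {d \<in> carrier G. d \<otimes> g = g \<otimes> d}"
  proof
    fix d assume "d \<in> {d \<in> carrier G. d \<otimes> g \<otimes> inv d = v}"
    then have d: "d \<in> carrier G" "d \<otimes> g \<otimes> inv d = v" by auto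
    have "d \<otimes> g = v \<otimes> d" using d g v by (metis inv_solve_right m_closed inv_closed)
    moreover have "e \<otimes> g = v \<otimes> e" using e g v by (metis inv_solve_right m_closed inv_closed)
    then have "inv e \<otimes> v = g \<otimes> inv e" using e g v
      by (metis inv_closed inv_solve_left inv_solve_right m_assoc m_closed)
    ultimately have "(inv e \<otimes> d) \<otimes> g = g \<otimes> (inv e \<otimes> d)" using e d g v
      by (metis inv_closed m_assoc)
    moreover have "d = e \<otimes> (inv e \<otimes> d)" using e d by (metis inv_closed l_one m_assoc r_inv)
    ultimately show "d \<in> (\<lambda>c. e \<otimes> c) ` {d \<in> carrier G. d \<otimes> g = g \<otimes> d}"
      using e d by (intro image_eqI[of _ _ "inv e \<otimes> d"]) auto
  qed
  then show ?thesis using fin finite_surj by blast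
next
  case False
  then have "{d \<in> carrier G. d \<otimes> g \<otimes> inv d = v} = {}" by blast
  then show ?thesis by (simp only: finite.emptyI)
qed

lemma escaping_conjugates:
  assumes g: "g \<in> carrier G" and inf: "infinite (carrier G)"
    and fin: "finite {d \<in> carrier G. d \<otimes> g = g \<otimes> d}"
  shows "escaping ((\<lambda>d. (d, d \<otimes> g)) ` carrier G)"
  unfolding escaping_def
proof (intro conjI allI)
  show "(\<lambda>d. (d, d \<otimes> g)) ` carrier G \<subseteq> carrier G \<times> carrier G" using g by auto
  fix r
  let ?B = "{d \<in> carrier G. len d \<le> r + len g}"
  let ?C = "\<Union>v\<in>{x \<in> carrier G. len x \<le> r}. {d \<in> carrier G. d \<otimes> g \<otimes> inv d = v}"
  have "finite (?B \<union> ?C)" using finite_conjugators[OF g _ fin] finite_len by auto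
  then obtain d where d: "d \<in> carrier G" "d \<notin> ?B \<union> ?C" using inf finite_subset[of "carrier G" "?B \<union> ?C"] by blast
  have 1: "len d > r + len g" using d by auto
  have "d = (d \<otimes> g) \<otimes> inv g" using d g by (simp add: m_assoc)
  then have "len d \<le> len (d \<otimes> g) + len g" using len_mult[of "d \<otimes> g" "inv g"] d g by (simp add: len_inv)
  then have 2: "len (d \<otimes> g) > r" using 1 by linarith
  have "gdist d (d \<otimes> g) = gdist (d \<otimes> g) d" using d g by (intro gdist_commute) auto
  also have "\<dots> = len (d \<otimes> g \<otimes> inv d)" by (simp add: gdist_def)
  also have "\<dots> > r"
  proof (rule ccontr)
    assume "\<not> r < len (d \<otimes> g \<otimes> inv d)"
    then have "d \<in> ?C" using d g by auto
    then show False using d by blast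
  qed
  finally have "gdist d (d \<otimes> g) > r" .
  moreover have "len d > r" using 1 by simp
  ultimately show "\<exists>(a, b)\<in>(\<lambda>d. (d, d \<otimes> g)) ` carrier G. r < len a \<and> r < len b \<and> r < gdist a b"
    using 2 d(1) by (intro bexI[of _ "(d, d \<otimes> g)"]) auto
qed

lemma escaping_square:
  assumes "A \<subseteq> carrier G" "infinite A"
  shows "escaping (A \<times> A)"
  unfolding escaping_def
proof (intro conjI allI)
  show "A \<times> A \<subseteq> carrier G \<times> carrier G" using assms by auto
  fix r
  have ex: "\<exists>a\<in>A. len a > k" for k
  proof (rule ccontr)
    assume "\<not> (\<exists>a\<in>A. len a > k)"
    then have "A \<subseteq> {x \<in> carrier G. len x \<le> k}" using assms by (auto simp: not_less)
    then show False using assms(2) finite_len finite_subset by blast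
  qed
  obtain a where a: "a \<in> A" "len a > r" using ex by blast
  obtain b where b: "b \<in> A" "len b > r + len a" using ex by blast
  have "len b \<le> gdist b a + len a" using a b assms by (intro len_le_gdist) auto
  then have "gdist b a > r" using b by linarith
  moreover have "gdist a b = gdist b a" using a b assms by (intro gdist_commute) auto
  ultimately have "gdist a b > r" by simp
  moreover have "len b > r" using b by simp
  ultimately show "\<exists>(a, b)\<in>A \<times> A. r < len a \<and> r < len b \<and> r < gdist a b"
    using a b(1) by (intro bexI[of _ "(a, b)"]) auto
qed

end

text \<open>
  For \<open>A\<close> infinite, the pairs in \<open>A \<times> A\<close> are escaping, and the tasks with \<open>p0 = p1\<close> make \<open>{a y | a \<in> A}\<close> dense in \<open>Y\<close>
  for every \<open>y\<close>. For freeness at \<open>g\<close> there are two cases. If the centralizer of \<open>g\<close> is infinite, it is added to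
  the family: some \<open>a\<close> in it moves \<open>y\<close> to a point with different values at the identity and at \<open>g\<close>, that
  is, \<open>y a \<noteq> y (g a) = y (a g)\<close>. If the centralizer is finite, then \<open>d\<close> and \<open>d g\<close> are far apart for most \<open>d\<close>, and the pairs
  \<open>(d, d g)\<close> are escaping; a task for these pairs yields \<open>d\<close> with \<open>y d \<noteq> y (d g)\<close>. In both cases \<open>g y \<noteq> y\<close>.
\<close>

theorem exists_free_dense_subshift:
  fixes G :: "('g, 'm) monoid_scheme" and \<A> :: "'g set set"
  assumes "group G" "countable (carrier G)" "infinite (carrier G)" "countable \<A>"
    and \<A>: "\<forall>A\<in>\<A>. A \<subseteq> carrier G \<and> infinite A"
  shows "\<exists>Y. closedin (shift_space G) Y \<and> Y \<noteq> {} \<and> (\<forall>y\<in>Y. \<forall>g\<in>carrier G. shift_action G g y \<in> Y) \<and>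
    (\<forall>A\<in>\<A>. \<forall>y\<in>Y. \<forall>z\<in>Y. \<forall>W. finite W \<longrightarrow> W \<subseteq> carrier G \<longrightarrow> (\<exists>a\<in>A. \<forall>x\<in>W. shift_action G a y x = z x)) \<and>
    (\<forall>y\<in>Y. \<forall>g\<in>carrier G. g \<noteq> \<one>\<^bsub>G\<^esub> \<longrightarrow> shift_action G g y \<noteq> y)"
proof -
  obtain len where len: "length_group G len" using exists_length_group assms(1,2) by blast
  interpret length_group G len by (rule len)
  define C where "C g = {d \<in> carrier G. d \<otimes>\<^bsub>G\<^esub> g = g \<otimes>\<^bsub>G\<^esub> d}" for g
  define \<B> where "\<B> = insert (carrier G) (\<A> \<union> {C g | g. g \<in> carrier G \<and> infinite (C g)})"
  define Pt where "Pt = {p :: 'g \<rightharpoonup> bool. finite (dom p) \<and> dom p \<subseteq> carrier G}"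
  define tasks where "tasks = (\<lambda>(A, p). (A \<times> A, p, p)) ` (\<B> \<times> Pt) \<union>
    (\<lambda>g. ((\<lambda>d. (d, d \<otimes>\<^bsub>G\<^esub> g)) ` carrier G, [\<one>\<^bsub>G\<^esub> \<mapsto> True], [\<one>\<^bsub>G\<^esub> \<mapsto> False])) ` {g \<in> carrier G. finite (C g)}"
  have \<B>: "A \<subseteq> carrier G" "infinite A" if "A \<in> \<B>" for A
    using that \<A> assms(3) by (auto simp: \<B>_def C_def)
  have "{C g | g. g \<in> carrier G \<and> infinite (C g)} \<subseteq> C ` carrier G" by blast
  then have "countable {C g | g. g \<in> carrier G \<and> infinite (C g)}"
    using countable_image[OF assms(2)] by (rule countable_subset)
  then have "countable \<B>" using assms(4) by (simp add: \<B>_def)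
  moreover have "countable Pt" unfolding Pt_def by (rule countable_finite_patches[OF assms(2)])
  moreover have "countable {g \<in> carrier G. finite (C g)}" using assms(2) by (rule countable_subset[rotated]) auto
  ultimately have ct: "countable tasks" unfolding tasks_def by blast
  have "Map.empty \<in> Pt" by (simp add: Pt_def)
  then have ne: "tasks \<noteq> {}" by (auto simp: tasks_def \<B>_def)
  have task: "escaping I \<and> finite (dom p0) \<and> dom p0 \<subseteq> carrier G \<and> finite (dom p1) \<and> dom p1 \<subseteq> carrier G"
    if t: "(I, p0, p1) \<in> tasks" for I p0 p1
  proof -
    show ?thesis
    proof (cases "(I, p0, p1) \<in> (\<lambda>(A, p). (A \<times> A, p, p)) ` (\<B> \<times> Pt)")
      case True
      then obtain A p where "A \<in> \<B>" "p \<in> Pt" "I = A \<times> A" "p0 = p" "p1 = p" by auto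
      then show ?thesis using escaping_square[OF \<B>] by (simp add: Pt_def)
    next
      case False
      then obtain g where g: "g \<in> carrier G" "finite (C g)" "I = (\<lambda>d. (d, d \<otimes>\<^bsub>G\<^esub> g)) ` carrier G"
        "p0 = [\<one>\<^bsub>G\<^esub> \<mapsto> True]" "p1 = [\<one>\<^bsub>G\<^esub> \<mapsto> False]"
        using t by (auto simp: tasks_def)
      then show ?thesis using escaping_conjugates[OF g(1) assms(3)] by (simp add: C_def)
    qed
  qed
  have tasks_ok: "\<forall>(I, p0, p1)\<in>tasks. escaping I \<and> finite (dom p0) \<and> dom p0 \<subseteq> carrier G \<and>
      finite (dom p1) \<and> dom p1 \<subseteq> carrier G"
    using task by blast
  obtain Y where Y: "closedin (shift_space G) Y" "\<forall>y\<in>Y. \<forall>g\<in>carrier G. shift_action G g y \<in> Y"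
    and small: "\<forall>q. finite (dom q) \<longrightarrow> dom q \<subseteq> carrier G \<longrightarrow> card (dom q) \<le> 2 \<longrightarrow> (\<exists>y\<in>Y. realises y q)"
    and hits: "\<forall>(I, p0, p1)\<in>tasks. (\<exists>y\<in>Y. realises y p0) \<longrightarrow> (\<exists>y\<in>Y. realises y p1) \<longrightarrow>
      (\<forall>y\<in>Y. \<exists>p\<in>I. realises (shift_action G (fst p) y) p0 \<and> realises (shift_action G (snd p) y) p1)"
    using exists_subshift[OF ct ne tasks_ok] by (elim exE conjE) (rule that)
  have YT: "y \<in> topspace (shift_space G)" if "y \<in> Y" for y using that Y(1) closedin_subset by blast
  have "\<exists>y\<in>Y. realises y Map.empty" using small by simp
  then have Yne: "Y \<noteq> {}" by blast
  have dense: "\<exists>a\<in>A. \<forall>x\<in>W. shift_action G a y x = z x"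
    if A: "A \<in> \<B>" and yz: "y \<in> Y" "z \<in> Y" and W: "finite W" "W \<subseteq> carrier G" for A y z W
  proof -
    define p where "p = (Some \<circ> z) |` W"
    have dp: "dom p = W" by (auto simp: p_def restrict_map_def split: if_splits)
    have "realises z p" by (auto simp: realises_def p_def restrict_map_def split: if_splits)
    moreover have "(A \<times> A, p, p) \<in> tasks" using A W dp by (force simp: tasks_def Pt_def)
    ultimately obtain c where c: "c \<in> A \<times> A" "realises (shift_action G (fst c) y) p"
      using hits yz by blast
    have "shift_action G (fst c) y x = z x" if "x \<in> W" for x
      using c(2) that dp unfolding realises_def p_def by (metis comp_apply option.inject restrict_in)
    then show ?thesis using c(1) by (metis mem_Times_iff)
  qed
  have free: "shift_action G g y \<noteq> y" if y: "y \<in> Y" and g: "g \<in> carrier G" "g \<noteq> \<one>\<^bsub>G\<^esub>" for y g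
  proof (cases "finite (C g)")
    case True
    have t: "((\<lambda>d. (d, d \<otimes>\<^bsub>G\<^esub> g)) ` carrier G, [\<one>\<^bsub>G\<^esub> \<mapsto> True], [\<one>\<^bsub>G\<^esub> \<mapsto> False]) \<in> tasks"
      using True g by (auto simp: tasks_def)
    have "\<exists>y\<in>Y. realises y [\<one>\<^bsub>G\<^esub> \<mapsto> b]" for b using small[rule_format, of "[\<one>\<^bsub>G\<^esub> \<mapsto> b]"] by simp
    note ex = this
    obtain p where p: "p \<in> (\<lambda>d. (d, d \<otimes>\<^bsub>G\<^esub> g)) ` carrier G"
      "realises (shift_action G (fst p) y) [\<one>\<^bsub>G\<^esub> \<mapsto> True]" "realises (shift_action G (snd p) y) [\<one>\<^bsub>G\<^esub> \<mapsto> False]"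
      using bspec[OF hits t, unfolded prod.case, THEN mp, THEN mp, THEN bspec, OF ex ex y] by blast
    then obtain d where d: "d \<in> carrier G" "p = (d, d \<otimes>\<^bsub>G\<^esub> g)" by blast
    have "y d" "\<not> y (d \<otimes>\<^bsub>G\<^esub> g)"
      using p(2,3) d g YT[OF y] by (auto simp: realises_def shift_action_def)
    moreover have "shift_action G g y d = y (d \<otimes>\<^bsub>G\<^esub> g)" using d YT[OF y] by (simp add: shift_action_def)
    ultimately show ?thesis by metis
  next
    case False
    let ?q = "[\<one>\<^bsub>G\<^esub> \<mapsto> False, g \<mapsto> True]"
    have "card (dom ?q) \<le> 2" by (simp add: card_insert_if)
    then obtain z where z: "z \<in> Y" "realises z ?q" using small[rule_format, of ?q] g by auto
    have CB: "C g \<in> \<B>" using False g by (auto simp: \<B>_def)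
    obtain a where a: "a \<in> C g" "\<forall>x\<in>{\<one>\<^bsub>G\<^esub>, g}. shift_action G a y x = z x"
      using dense[OF CB y z(1), of "{\<one>\<^bsub>G\<^esub>, g}"] g by auto
    have aG: "a \<in> carrier G" "a \<otimes>\<^bsub>G\<^esub> g = g \<otimes>\<^bsub>G\<^esub> a" using a by (auto simp: C_def)
    have "\<not> z \<one>\<^bsub>G\<^esub>" "z g" using z(2) g by (auto simp: realises_def)
    then have "\<not> y a" "y (g \<otimes>\<^bsub>G\<^esub> a)" using a(2) aG g YT[OF y] by (auto simp: shift_action_def)
    moreover have "shift_action G g y a = y (g \<otimes>\<^bsub>G\<^esub> a)" using aG YT[OF y] by (simp add: shift_action_def)
    ultimately show ?thesis by metis
  qed
  have sub: "\<A> \<subseteq> \<B>" by (auto simp: \<B>_def)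
  show ?thesis
  proof (intro exI[of _ Y] conjI ballI allI impI)
    fix A y z W assume "A \<in> \<A>" "y \<in> Y" "z \<in> Y" "finite W" "W \<subseteq> carrier G"
    then show "\<exists>a\<in>A. \<forall>x\<in>W. shift_action G a y x = z x" using dense sub by blast
  qed (use Y Yne free in auto)
qed

section \<open>Return sets in flows without wandering points\<close>

lemma exists_pi_base:
  assumes "metrizable_space X" "separable_space X"
  shows "\<exists>\<B>. countable \<B> \<and> (\<forall>B\<in>\<B>. openin X B \<and> B \<noteq> {}) \<and> (\<forall>U. openin X U \<longrightarrow> U \<noteq> {} \<longrightarrow> (\<exists>B\<in>\<B>. B \<subseteq> U))"
proof -
  obtain M d where "Metric_space M d" and X: "X = Metric_space.mtopology M d"
    using assms(1) unfolding metrizable_space_def by blast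
  then interpret Metric_space M d by simp
  obtain C where C: "countable C" "C \<subseteq> M" "X closure_of C = topspace X"
    using assms(2) unfolding separable_space_def X by auto
  define \<B> where "\<B> = (\<lambda>(c, n). mball c (1 / real (Suc n))) ` (C \<times> (UNIV :: nat set))"
  have "countable \<B>" using C(1) by (simp add: \<B>_def)
  moreover have "openin X B \<and> B \<noteq> {}" if B: "B \<in> \<B>" for B
  proof -
    obtain c n where c: "c \<in> C" "B = mball c (1 / real (Suc n))" using B by (auto simp: \<B>_def)
    then have "c \<in> B" using C(2) by auto
    moreover have "openin X B" using c X by simp
    ultimately show ?thesis by blast
  qed
  moreover have "\<exists>B\<in>\<B>. B \<subseteq> U" if U: "openin X U" "U \<noteq> {}" for U
  proof -
    obtain x where x: "x \<in> U" using U by blast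
    obtain r where r: "r > 0" "mball x r \<subseteq> U" using U(1) x unfolding X openin_mtopology by blast
    have xM: "x \<in> M" using U(1) x openin_subset X by fastforce
    obtain n where n: "1 / real (Suc n) < r / 2" using r(1) by (meson half_gt_zero nat_approx_posE)
    let ?e = "1 / real (Suc n)"
    have "x \<in> mball x ?e" using xM by simp
    then have "mball x ?e \<noteq> {}" by blast
    moreover have "openin X (mball x ?e)" using X by simp
    ultimately obtain c where c: "c \<in> C" "c \<in> mball x ?e" using C(3) unfolding dense_intersects_open by blast
    have "mball c ?e \<subseteq> mball x r"
    proof
      fix z assume z: "z \<in> mball c ?e"
      have "d x z \<le> d x c + d c z" using xM c z C(2) by (intro triangle) auto
      then show "z \<in> mball x r" using z c xM n by auto
    qed
    moreover have "mball c ?e \<in> \<B>" using c by (auto simp: \<B>_def)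
    ultimately show ?thesis using r(2) by blast
  qed
  ultimately show ?thesis by blast
qed

lemma continuous_map_flow:
  assumes "flow G X a" "g \<in> carrier G"
  shows "continuous_map X X (a g)"
proof -
  have "continuous_map X (prod_topology (discrete_topology (carrier G)) X) (\<lambda>x. (g, x))"
    using assms(2) by (simp add: continuous_map_pairedI)
  moreover have "continuous_map (prod_topology (discrete_topology (carrier G)) X) X (\<lambda>(g, x). a g x)"
    using assms(1) by (simp add: flow_def)
  ultimately have "continuous_map X X ((\<lambda>(g, x). a g x) \<circ> (\<lambda>x. (g, x)))" by (rule continuous_map_compose)
  then show ?thesis by (simp add: o_def)
qed

text \<open>
  For a finite set \<open>F\<close>, the points that return to \<open>B\<close> under some element outside \<open>F\<close> form an open set, and this set is dense
  in \<open>B\<close> because every nonempty open subset of \<open>B\<close> meets infinitely many of its translates. Baire's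
  theorem yields a point of \<open>B\<close> that belongs to all these sets.
\<close>

lemma exists_returning_point:
  assumes "polish_flow G X a" "countable (carrier G)"
    and nw: "\<not> (\<exists>x\<in>topspace X. wandering_point G X a x)"
    and B: "openin X B" "B \<noteq> {}"
  shows "\<exists>x\<in>B. infinite {g \<in> carrier G. a g x \<in> B}"
proof -
  have fl: "flow G X a" and cm: "completely_metrizable_space X" using assms(1) by (auto simp: polish_flow_def)
  have BX: "B \<subseteq> topspace X" using B(1) by (rule openin_subset)
  define R where "R F = {x \<in> B. \<exists>g\<in>carrier G - F. a g x \<in> B}" for F
  \<comment> \<open>The complement of the closure of \<open>B\<close> is added to make the set dense in the whole space.\<close>
  define T where "T F = R F \<union> (topspace X - X closure_of B)" for F
  define \<G> where "\<G> = T ` {F. finite F \<and> F \<subseteq> carrier G}"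
  have "X closure_of \<Inter>\<G> = topspace X"
  proof (rule Baire_category)
    show "completely_metrizable_space X \<or> locally_compact_space X \<and> regular_space X" using cm by simp
    show "countable \<G>" unfolding \<G>_def by (intro countable_image countable_Collect_finite_subset assms(2))
    fix S assume "S \<in> \<G>"
    then obtain F where F: "finite F" "F \<subseteq> carrier G" "S = T F" by (auto simp: \<G>_def)
    have "R F = (\<Union>g\<in>carrier G - F. B \<inter> {x \<in> topspace X. a g x \<in> B})" using BX by (auto simp: R_def)
    moreover have "openin X (B \<inter> {x \<in> topspace X. a g x \<in> B})" if "g \<in> carrier G" for g
      using B(1) openin_continuous_map_preimage[OF continuous_map_flow[OF fl that] B(1)] by blast
    ultimately have "openin X (R F)" by (simp only:) (rule openin_Union, blast)
    then have "openin X S" unfolding F T_def by (intro openin_Un openin_diff) auto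
    moreover have "S \<inter> U \<noteq> {}" if U: "openin X U" "U \<noteq> {}" for U
    proof (cases "U \<inter> B = {}")
      case True
      then have "U \<inter> X closure_of B = {}" using U(1) openin_Int_closure_of_eq_empty by blast
      then show ?thesis using U openin_subset unfolding F T_def by blast
    next
      case False
      then obtain x where x: "x \<in> U \<inter> B" by blast
      have op: "openin X (U \<inter> B)" using U B by auto
      have "\<not> wandering_point G X a x" using nw x BX by blast
      then have "\<not> wandering_set G X a (U \<inter> B)" using op x unfolding wandering_point_def by blast
      then have "infinite {g \<in> carrier G. (U \<inter> B) \<inter> a g ` (U \<inter> B) \<noteq> {}}"
        using BX unfolding wandering_set_def by blast
      then have "\<not> {g \<in> carrier G. (U \<inter> B) \<inter> a g ` (U \<inter> B) \<noteq> {}} \<subseteq> F"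
        using F(1) finite_subset by blast
      then obtain g where g: "g \<in> carrier G" "(U \<inter> B) \<inter> a g ` (U \<inter> B) \<noteq> {}" "g \<notin> F"
        by blast
      then have "R F \<inter> U \<noteq> {}" unfolding R_def by blast
      then show ?thesis unfolding F T_def by blast
    qed
    ultimately show "openin X S \<and> X closure_of S = topspace X" unfolding dense_intersects_open by blast
  qed
  then obtain x where x: "x \<in> \<Inter>\<G>" "x \<in> B" using B unfolding dense_intersects_open by blast
  have xc: "x \<in> X closure_of B" using x(2) closure_of_subset[OF BX] by blast
  have "infinite {g \<in> carrier G. a g x \<in> B}"
  proof
    let ?F = "{g \<in> carrier G. a g x \<in> B}"
    assume "finite ?F"
    then have "x \<in> T ?F" using x(1) by (auto simp: \<G>_def)
    then have "x \<in> R ?F" using xc by (auto simp: T_def)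
    then show False by (auto simp: R_def)
  qed
  then show ?thesis using x(2) by blast
qed

lemma exists_return_sets:
  assumes "polish_flow G X a" "countable (carrier G)"
    and "\<not> (\<exists>x\<in>topspace X. wandering_point G X a x)"
  shows "\<exists>\<A>. countable \<A> \<and> (\<forall>A\<in>\<A>. A \<subseteq> carrier G \<and> infinite A) \<and>
    (\<forall>U. openin X U \<longrightarrow> U \<noteq> {} \<longrightarrow> (\<exists>x\<in>U. \<exists>A\<in>\<A>. \<forall>g\<in>A. a g x \<in> U))"
proof -
  have "metrizable_space X" "separable_space X"
    using assms(1) completely_metrizable_imp_metrizable_space by (auto simp: polish_flow_def)
  then obtain \<B> where \<B>: "countable \<B>" "\<And>B. B \<in> \<B> \<Longrightarrow> openin X B \<and> B \<noteq> {}"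
    "\<And>U. openin X U \<Longrightarrow> U \<noteq> {} \<Longrightarrow> \<exists>B\<in>\<B>. B \<subseteq> U"
    using exists_pi_base by metis
  have "\<forall>B\<in>\<B>. \<exists>x. x \<in> B \<and> infinite {g \<in> carrier G. a g x \<in> B}"
    using exists_returning_point[OF assms] \<B>(2) by blast
  then obtain x where x: "\<And>B. B \<in> \<B> \<Longrightarrow> x B \<in> B \<and> infinite {g \<in> carrier G. a g (x B) \<in> B}" by metis
  define \<A> where "\<A> = (\<lambda>B. {g \<in> carrier G. a g (x B) \<in> B}) ` \<B>"
  have "\<exists>x\<in>U. \<exists>A\<in>\<A>. \<forall>g\<in>A. a g x \<in> U" if U: "openin X U" "U \<noteq> {}" for U
  proof -
    obtain B where B: "B \<in> \<B>" "B \<subseteq> U" using \<B>(3)[OF U] by blast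
    have "\<forall>g\<in>{g \<in> carrier G. a g (x B) \<in> B}. a g (x B) \<in> U" using B by blast
    moreover have "x B \<in> U" using x[OF B(1)] B(2) by blast
    ultimately show ?thesis using B(1) unfolding \<A>_def by blast
  qed
  moreover have "countable \<A>" using \<B>(1) by (simp add: \<A>_def)
  moreover have "\<forall>A\<in>\<A>. A \<subseteq> carrier G \<and> infinite A" using x by (auto simp: \<A>_def)
  ultimately show ?thesis by blast
qed

section \<open>Disjointness\<close>

lemma shift_action_mult:
  assumes "group G" "y \<in> topspace (shift_space G)" "g \<in> carrier G" "h \<in> carrier G"
  shows "shift_action G (g \<otimes>\<^bsub>G\<^esub> h) y = shift_action G g (shift_action G h y)"
proof -
  interpret group G by fact
  show ?thesis using assms by (auto simp: shift_action_def topspace_shift_space fun_eq_iff m_assoc restrict_def)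
qed

lemma shift_action_one:
  assumes "group G" "y \<in> topspace (shift_space G)"
  shows "shift_action G \<one>\<^bsub>G\<^esub> y = y"
proof -
  interpret group G by fact
  show ?thesis using assms
    by (auto simp: shift_action_def topspace_shift_space fun_eq_iff restrict_def PiE_iff extensional_def)
qed

lemma group_action_shift:
  assumes "group G" "Y \<subseteq> topspace (shift_space G)" and inv: "\<And>y g. y \<in> Y \<Longrightarrow> g \<in> carrier G \<Longrightarrow> shift_action G g y \<in> Y"
  shows "group_action G Y (restrict_action (shift_action G) Y)"
proof -
  interpret group G by fact
  have bij: "restrict_action (shift_action G) Y g \<in> Bij Y" if g: "g \<in> carrier G" for g
  proof -
    have inv2: "shift_action G (inv\<^bsub>G\<^esub> g) (shift_action G g y) = y" "shift_action G g (shift_action G (inv\<^bsub>G\<^esub> g) y) = y" if "y \<in> Y" for y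
      using that g assms(2) shift_action_one[OF assms(1), of y] shift_action_mult[OF assms(1), of y "inv\<^bsub>G\<^esub> g" g]
        shift_action_mult[OF assms(1), of y g "inv\<^bsub>G\<^esub> g"] by auto
    have "bij_betw (restrict_action (shift_action G) Y g) Y Y"
      by (rule bij_betw_byWitness[where f' = "shift_action G (inv\<^bsub>G\<^esub> g)"])
         (use inv inv2 g in \<open>auto simp: restrict_action_def\<close>)
    then show ?thesis by (simp add: Bij_def restrict_action_def)
  qed
  have "group_hom G (BijGroup Y) (restrict_action (shift_action G) Y)"
  proof (intro group_hom.intro group_hom_axioms.intro homI)
    show "group G" by fact
    show "group (BijGroup Y)" by (rule group_BijGroup)
    show "restrict_action (shift_action G) Y g \<in> carrier (BijGroup Y)" if "g \<in> carrier G" for g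
      using bij[OF that] by (simp add: BijGroup_def)
    fix g h assume gh: "g \<in> carrier G" "h \<in> carrier G"
    have "restrict_action (shift_action G) Y (g \<otimes>\<^bsub>G\<^esub> h) =
        compose Y (restrict_action (shift_action G) Y g) (restrict_action (shift_action G) Y h)"
      using gh inv assms(2) shift_action_mult[OF assms(1)]
      by (auto simp: restrict_action_def compose_def fun_eq_iff restrict_def subset_iff)
    then show "restrict_action (shift_action G) Y (g \<otimes>\<^bsub>G\<^esub> h) =
        restrict_action (shift_action G) Y g \<otimes>\<^bsub>BijGroup Y\<^esub> restrict_action (shift_action G) Y h"
      using bij gh by (simp add: BijGroup_def)
  qed
  then show ?thesis by (rule group_action.intro)
qed

lemma continuous_map_discrete_prod:
  assumes "\<And>g. g \<in> C \<Longrightarrow> continuous_map X Z (f g)"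
  shows "continuous_map (prod_topology (discrete_topology C) X) Z (\<lambda>(g, x). f g x)"
  unfolding continuous_map_def
proof (intro conjI allI impI)
  show "(\<lambda>(g, x). f g x) \<in> topspace (prod_topology (discrete_topology C) X) \<rightarrow> topspace Z"
    using assms by (auto simp: continuous_map_def Pi_iff)
  fix U assume U: "openin Z U"
  have "{p \<in> topspace (prod_topology (discrete_topology C) X). (case p of (g, x) \<Rightarrow> f g x) \<in> U} =
    (\<Union>g\<in>C. {g} \<times> {x \<in> topspace X. f g x \<in> U})" by auto
  moreover have "openin (prod_topology (discrete_topology C) X) ({g} \<times> {x \<in> topspace X. f g x \<in> U})" if "g \<in> C" for g
    using openin_continuous_map_preimage[OF assms[OF that] U] that by (simp add: openin_prod_Times_iff)
  ultimately show "openin (prod_topology (discrete_topology C) X)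
      {p \<in> topspace (prod_topology (discrete_topology C) X). (case p of (g, x) \<Rightarrow> f g x) \<in> U}" by auto
qed

lemma flow_shift:
  assumes "group G" "closedin (shift_space G) Y" "Y \<noteq> {}"
    and inv: "\<And>y g. y \<in> Y \<Longrightarrow> g \<in> carrier G \<Longrightarrow> shift_action G g y \<in> Y"
  shows "flow G (subtopology (shift_space G) Y) (restrict_action (shift_action G) Y)"
proof -
  interpret group G by fact
  have YT: "Y \<subseteq> topspace (shift_space G)" using assms(2) by (rule closedin_subset)
  then have top: "topspace (subtopology (shift_space G) Y) = Y" by (rule topspace_subtopology_subset)
  have "compactin (shift_space G) Y"
    using closedin_compact_space[OF compact_space_shift_space assms(2)] .
  then have "compact_space (subtopology (shift_space G) Y)" by (rule compact_space_subtopology)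
  moreover have "Hausdorff_space (subtopology (shift_space G) Y)"
    using Hausdorff_space_shift_space by (rule Hausdorff_space_subtopology)
  moreover have "continuous_map (subtopology (shift_space G) Y) (subtopology (shift_space G) Y)
      (restrict_action (shift_action G) Y g)" if g: "g \<in> carrier G" for g
  proof -
    have "continuous_map (subtopology (shift_space G) Y) (shift_space G) (restrict_action (shift_action G) Y g)"
      unfolding shift_space_def continuous_map_componentwise
    proof (intro conjI ballI)
      show "restrict_action (shift_action G) Y g `
          topspace (subtopology (product_topology (\<lambda>_. discrete_topology UNIV) (carrier G)) Y) \<subseteq> extensional (carrier G)"
        using YT by (auto simp: restrict_action_def shift_action_def shift_space_def)
      fix d assume d: "d \<in> carrier G"
      have "continuous_map (subtopology (product_topology (\<lambda>_. discrete_topology (UNIV :: bool set)) (carrier G)) Y)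
          (discrete_topology UNIV) (\<lambda>y. y (d \<otimes>\<^bsub>G\<^esub> g))"
        using d g by (intro continuous_map_from_subtopology continuous_map_product_projection) auto
      then show "continuous_map (subtopology (product_topology (\<lambda>_. discrete_topology UNIV) (carrier G)) Y)
          (discrete_topology UNIV) (\<lambda>y. restrict_action (shift_action G) Y g y d)"
        by (rule continuous_map_eq) (use d YT in \<open>auto simp: restrict_action_def shift_action_def shift_space_def\<close>)
    qed
    then show ?thesis unfolding continuous_map_in_subtopology top using inv g by (auto simp: restrict_action_def)
  qed
  then have "continuous_map (prod_topology (discrete_topology (carrier G)) (subtopology (shift_space G) Y))
      (subtopology (shift_space G) Y) (\<lambda>(g, x). restrict_action (shift_action G) Y g x)"
    by (rule continuous_map_discrete_prod)
  ultimately show ?thesis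
    using group_action_shift[OF assms(1) YT inv] assms(3) unfolding flow_def top by blast
qed

theorem theorem1p15:
  fixes G :: "('g, 'm) monoid_scheme"
    and X :: "nat \<Rightarrow> 'a topology"
    and a :: "nat \<Rightarrow> 'g \<Rightarrow> 'a \<Rightarrow> 'a"
  assumes "group G"
    and "countable (carrier G)" and "infinite (carrier G)"
    and "\<And>n. polish_flow G (X n) (a n)"
    and "\<And>n. \<not> (\<exists>x\<in>topspace (X n). wandering_point G (X n) (a n) x)"
  shows "\<exists>Y. subflow G (shift_space G) (shift_action G) Y \<and>
    free_flow G (subtopology (shift_space G) Y) (restrict_action (shift_action G) Y) \<and>
    minimal_flow G (subtopology (shift_space G) Y) (restrict_action (shift_action G) Y) \<and>
    (\<forall>n. disjoint_flows G (subtopology (shift_space G) Y) (restrict_action (shift_action G) Y)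
                          (X n) (a n))"
proof -
  have "\<forall>n. \<exists>\<A>. countable \<A> \<and> (\<forall>A\<in>\<A>. A \<subseteq> carrier G \<and> infinite A) \<and>
    (\<forall>U. openin (X n) U \<longrightarrow> U \<noteq> {} \<longrightarrow> (\<exists>x\<in>U. \<exists>A\<in>\<A>. \<forall>g\<in>A. a n g x \<in> U))"
    using exists_return_sets[OF assms(4,2,5)] by blast
  then obtain \<A> where \<A>: "\<And>n. countable (\<A> n)" "\<And>n A. A \<in> \<A> n \<Longrightarrow> A \<subseteq> carrier G \<and> infinite A"
    "\<And>n U. openin (X n) U \<Longrightarrow> U \<noteq> {} \<Longrightarrow> \<exists>x\<in>U. \<exists>A\<in>\<A> n. \<forall>g\<in>A. a n g x \<in> U" by metis
  define \<B> where "\<B> = insert (carrier G) (\<Union>n. \<A> n)"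
  have c\<B>: "countable \<B>" using \<A>(1) by (simp add: \<B>_def)
  have inf\<B>: "\<forall>A\<in>\<B>. A \<subseteq> carrier G \<and> infinite A" using \<A>(2) assms(3) by (simp add: \<B>_def)
  obtain Y where Y: "closedin (shift_space G) Y" "Y \<noteq> {}" "\<forall>y\<in>Y. \<forall>g\<in>carrier G. shift_action G g y \<in> Y"
    and dense: "\<forall>A\<in>\<B>. \<forall>y\<in>Y. \<forall>z\<in>Y. \<forall>W. finite W \<longrightarrow> W \<subseteq> carrier G \<longrightarrow> (\<exists>a\<in>A. \<forall>x\<in>W. shift_action G a y x = z x)"
    and free: "\<forall>y\<in>Y. \<forall>g\<in>carrier G. g \<noteq> \<one>\<^bsub>G\<^esub> \<longrightarrow> shift_action G g y \<noteq> y"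
    using exists_free_dense_subshift[OF assms(1-3) c\<B> inf\<B>] by (elim exE conjE) (rule that)
  have YT: "Y \<subseteq> topspace (shift_space G)" using Y(1) by (rule closedin_subset)
  then have top: "topspace (subtopology (shift_space G) Y) = Y" by (rule topspace_subtopology_subset)
  have flow: "flow G (subtopology (shift_space G) Y) (restrict_action (shift_action G) Y)"
    using Y by (intro flow_shift[OF assms(1)]) auto
  \<comment> \<open>Density of \<open>{g y | g \<in> A}\<close> in \<open>Y\<close>; the case \<open>A = carrier G\<close> is minimality.\<close>
  have hit: "\<exists>g\<in>A. shift_action G g y \<in> V"
    if A: "A \<in> \<B>" and V: "openin (subtopology (shift_space G) Y) V" and z: "z \<in> V" and y: "y \<in> Y" for A V z y
  proof -
    obtain V' where V': "openin (shift_space G) V'" "V = V' \<inter> Y" using V by (auto simp: openin_subtopology)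
    then have zV: "z \<in> V'" "z \<in> Y" using z by auto
    obtain W where W: "finite W" "W \<subseteq> carrier G"
      "{w \<in> topspace (shift_space G). \<forall>x\<in>W. w x = z x} \<subseteq> V'"
      using openin_shift_space_cylinder[OF V'(1) zV(1)] by blast
    obtain g where g: "g \<in> A" "\<forall>x\<in>W. shift_action G g y x = z x" using dense[rule_format, OF A y zV(2) W(1,2)] by blast
    have "g \<in> carrier G" using A g(1) \<A>(2) by (auto simp: \<B>_def)
    then have "shift_action G g y \<in> Y" using Y(3) y by blast
    then show ?thesis using g W(3) V'(2) YT by blast
  qed
  have AG: "g \<in> carrier G" if "A \<in> \<B>" "g \<in> A" for A g using that \<A>(2) by (auto simp: \<B>_def)
  show ?thesis
  proof (intro exI[of _ Y] conjI allI)
    show "subflow G (shift_space G) (shift_action G) Y" using Y by (auto simp: subflow_def)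
    show "free_flow G (subtopology (shift_space G) Y) (restrict_action (shift_action G) Y)"
      using flow free by (simp add: free_flow_def top restrict_action_def)
    show "minimal_flow G (subtopology (shift_space G) Y) (restrict_action (shift_action G) Y)"
      unfolding minimal_flow_def top
    proof (intro conjI allI impI flow)
      fix Z assume "subflow G (subtopology (shift_space G) Y) (restrict_action (shift_action G) Y) Z"
      then have Z: "Z \<noteq> {}" "closedin (subtopology (shift_space G) Y) Z"
        "\<forall>g\<in>carrier G. restrict_action (shift_action G) Y g ` Z \<subseteq> Z" by (auto simp: subflow_def)
      have ZY: "Z \<subseteq> Y" using closedin_subset[OF Z(2)] top by simp
      obtain y where y: "y \<in> Z" using Z(1) by blast
      show "Z = Y"
      proof (rule ccontr)
        assume "Z \<noteq> Y"
        then obtain z where z: "z \<in> Y - Z" using ZY by blast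
        have "openin (subtopology (shift_space G) Y) (Y - Z)" using Z(2) top by (metis closedin_def)
        then obtain g where g: "g \<in> carrier G" "shift_action G g y \<in> Y - Z"
          using hit[of "carrier G" "Y - Z" z y] z y ZY by (auto simp: \<B>_def)
        moreover have "restrict_action (shift_action G) Y g y \<in> Z" using Z(3) g(1) y by blast
        then have "shift_action G g y \<in> Z" using y ZY by (simp add: restrict_action_def subset_iff)
        ultimately show False by blast
      qed
    qed
    fix n
    show "disjoint_flows G (subtopology (shift_space G) Y) (restrict_action (shift_action G) Y) (X n) (a n)"
      unfolding disjoint_flows_def top
    proof (intro allI impI)
      let ?YX = "prod_topology (subtopology (shift_space G) Y) (X n)"
      let ?act = "diagonal_action (subtopology (shift_space G) Y) (restrict_action (shift_action G) Y) (X n) (a n)"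
      fix Z assume "joining G (subtopology (shift_space G) Y) (restrict_action (shift_action G) Y) (X n) (a n) Z"
      then have Z: "closedin ?YX Z" "\<And>g. g \<in> carrier G \<Longrightarrow> ?act g ` Z \<subseteq> Z" "snd ` Z = topspace (X n)"
        by (auto simp: joining_def subflow_def)
      have ZY: "Z \<subseteq> Y \<times> topspace (X n)" using closedin_subset[OF Z(1)] top by simp
      show "Z = Y \<times> topspace (X n)"
      proof (rule ccontr)
        assume "Z \<noteq> Y \<times> topspace (X n)"
        then obtain z x0 where zx: "z \<in> Y" "x0 \<in> topspace (X n)" "(z, x0) \<notin> Z" using ZY by blast
        have op: "openin ?YX (Y \<times> topspace (X n) - Z)" using Z(1) top by (metis closedin_def topspace_prod_topology)
        have mem: "(z, x0) \<in> Y \<times> topspace (X n) - Z" using zx by blast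
        obtain V U where VU: "openin (subtopology (shift_space G) Y) V" "openin (X n) U"
          "z \<in> V" "x0 \<in> U" "V \<times> U \<subseteq> Y \<times> topspace (X n) - Z"
          using op[unfolded openin_prod_topology_alt, THEN spec, THEN spec, THEN mp, OF mem] by blast
        \<comment> \<open>\<open>g x\<close> stays in \<open>U\<close> for \<open>g\<close> in the return set \<open>A\<close>, while some \<open>g y\<close> with \<open>g \<in> A\<close> lies in \<open>V\<close>.\<close>
        obtain x A where xA: "x \<in> U" "A \<in> \<A> n" "\<forall>g\<in>A. a n g x \<in> U" using \<A>(3)[OF VU(2)] VU(4) by blast
        have "x \<in> topspace (X n)" using openin_subset[OF VU(2)] xA(1) by blast
        then obtain y where y: "(y, x) \<in> Z" using Z(3) by (metis imageE prod.collapse)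
        have yY: "y \<in> Y" using y ZY by blast
        have AB: "A \<in> \<B>" using xA(2) by (auto simp: \<B>_def)
        obtain g where g: "g \<in> A" "shift_action G g y \<in> V" using hit[OF AB VU(1,3) yY] by blast
        have "?act g (y, x) \<in> Z" using Z(2)[OF AG[OF AB g(1)]] y by blast
        then have "(shift_action G g y, a n g x) \<in> Z"
          using yY subsetD[OF YT yY] \<open>x \<in> topspace (X n)\<close> by (simp add: diagonal_action_def top restrict_action_def)
        moreover have "(shift_action G g y, a n g x) \<in> V \<times> U" using g xA(3) by blast
        ultimately show False using VU(5) by blast
      qed
    qed
  qed
qed

end
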